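(* Let $G$ be an arbitrary abelian group. Then $\mathcal{P}_f(G)=\mathcal{Q}_f(G)$; that is, a finitely generated subgroup $H\le G$ has the property that every monomorphism $H\to G$ extends to an endomorphism of $G$ if and only if every homomorphism $H\to G$ extends to an endomorphism of $G$.
   Context: For an abelian group $G$: $\mathcal{Q}(G)$ is the set of subgroups $N\le G$ such that every homomorphism $N\to G$ extends to an endomorphism of $G$; $\mathcal{P}(G)$ is the set of subgroups $N\le G$ such that every monomorphism $N\to G$ extends to an endomorphism of $G$. $\mathcal{Q}_f(G)$ and $\mathcal{P}_f(G)$ denote the sets of finitely generated subgroups in $\mathcal{Q}(G)$ and $\mathcal{P}(G)$, respectively. *)

theory Defs
  imports "HOL-Algebra.Generated_Groups"
begin

text \<open>HOL-Algebra homomorphisms are total functions on the underlying type whose values outside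
  the carrier are irrelevant, so extending \<open>f\<close> means agreeing with it on the carrier of its domain.\<close>

definition extends_to_endo :: "('a, 'b) monoid_scheme \<Rightarrow> 'a set \<Rightarrow> ('a \<Rightarrow> 'a) \<Rightarrow> bool" where
  "extends_to_endo G N f \<longleftrightarrow> (\<exists>g \<in> hom G G. \<forall>x \<in> N. g x = f x)"

definition Q_subgroups :: "('a, 'b) monoid_scheme \<Rightarrow> 'a set set" where
  "Q_subgroups G =
    {N. subgroup N G \<and> (\<forall>f \<in> hom (G\<lparr>carrier := N\<rparr>) G. extends_to_endo G N f)}"

definition P_subgroups :: "('a, 'b) monoid_scheme \<Rightarrow> 'a set set" where
  "P_subgroups G =
    {N. subgroup N G \<and> (\<forall>f \<in> mon (G\<lparr>carrier := N\<rparr>) G. extends_to_endo G N f)}"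

definition fin_gen_subgroup :: "('a, 'b) monoid_scheme \<Rightarrow> 'a set \<Rightarrow> bool" where
  "fin_gen_subgroup G N \<longleftrightarrow> (\<exists>S. finite S \<and> S \<subseteq> carrier G \<and> N = generate G S)"

definition Qf_subgroups :: "('a, 'b) monoid_scheme \<Rightarrow> 'a set set" where
  "Qf_subgroups G = {N \<in> Q_subgroups G. fin_gen_subgroup G N}"

definition Pf_subgroups :: "('a, 'b) monoid_scheme \<Rightarrow> 'a set set" where
  "Pf_subgroups G = {N \<in> P_subgroups G. fin_gen_subgroup G N}"

end

theory Submission
  imports Defs "HOL-Computational_Algebra.Primes" "HOL-Algebra.Multiplicative_Group"
begin

text \<open>
  Let \<open>H\<close> be a finitely generated subgroup of \<open>G\<close> all of whose monomorphisms into \<open>G\<close> extend. The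
  homomorphisms \<open>H \<rightarrow> G\<close> that extend to endomorphisms form a group under pointwise multiplication
  which contains every monomorphism, in particular the inclusion. So a homomorphism \<open>f\<close> extends as
  soon as \<open>h \<mapsto> h \<otimes> f h\<close> is injective, and the point is to build all homomorphisms from such
  perturbations of the inclusion.

  Write \<open>H\<close> as an internal direct product of cyclic groups (\<open>independent_generators_exist\<close>). For a
  factor \<open>\<langle>c\<rangle>\<close> with complement \<open>B\<close> it suffices to extend each homomorphism \<open>c \<mapsto> g\<close> that is trivial
  on \<open>B\<close>; call \<open>g\<close> realizable if this is possible. If \<open>c\<close> has infinite order, then \<open>c \<mapsto> c \<otimes> g\<close> or
  \<open>c \<mapsto> c\<^sup>2 \<otimes> g\<close> is injective together with the identity on \<open>B\<close>. A finite order splits into coprime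
  parts, which leaves \<open>c\<close> of order \<open>p ^ Suc e\<close> for a prime \<open>p\<close>. Let \<open>s = c ^ (p ^ e)\<close> generate the
  socle of \<open>\<langle>c\<rangle>\<close>. The perturbation by \<open>g\<close> is injective unless \<open>s \<otimes> g ^ (p ^ e)\<close> lies in \<open>B\<close>
  (\<open>realizable_perturbation\<close>), and in that exceptional case \<open>g \<otimes> inv c\<close> is not exceptional. Hence
  everything reduces to realizing \<open>g = c\<close>, that is, to extending the projection of \<open>H\<close> onto \<open>\<langle>c\<rangle>\<close>
  (\<open>realizable_generator_prime_power\<close>).

  If some \<open>g\<close> with \<open>g ^ (p ^ Suc e) = \<one>\<close> has \<open>g ^ (p ^ e)\<close> outside \<open>H\<close>, then \<open>g\<close> and \<open>c \<otimes> inv g\<close> are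
  both unexceptional and their product is \<open>c\<close>. Otherwise it is enough to realize one \<open>z\<close> with
  \<open>z ^ (p ^ e) = s\<close>, because \<open>c \<otimes> inv z\<close> is then unexceptional. Two cases remain, according to the
  \<open>p\<close>-height of \<open>s\<close>, and in both the endomorphism is constructed directly by Zorn's lemma
  (\<open>extend_into_p_group\<close>).

  If \<open>s = y ^ (p ^ m)\<close> is no \<open>p ^ Suc m\<close>-th power, a homomorphism \<open>G \<rightarrow> \<langle>y\<rangle>\<close> that is trivial on \<open>B\<close>
  and sends \<open>c\<close> to such a \<open>z\<close> exists unless \<open>s\<close> is a product of some \<open>h\<close> in \<open>B\<close> and a
  \<open>p ^ Suc m\<close>-th power. The latter is impossible: \<open>h\<close> is not a \<open>p ^ Suc m\<close>-th power in \<open>B\<close>, since \<open>s\<close>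
  would be one in \<open>G\<close>, so some homomorphism \<open>B \<rightarrow> \<langle>y\<rangle>\<close> does not kill \<open>h\<close>. Perturbing the inclusion by
  it preserves injectivity, so it extends, and its extension exhibits \<open>s\<close> as a \<open>p ^ Suc m\<close>-th power
  (\<open>realizable_root_finite_height\<close>).

  If \<open>s\<close> has infinite height, then all elements of order \<open>p\<close> and height at least \<open>e\<close> lie in the finite
  set of elements of \<open>H\<close> killed by \<open>p\<close>. The descending chain of socles of the groups of
  \<open>p ^ n\<close>-th powers therefore stabilizes, which makes the \<open>p\<close>-torsion of high powers divisible
  (\<open>divisible_part\<close>). This divisible group contains some \<open>z\<close> as required, and homomorphisms into it
  extend to all of \<open>G\<close> (\<open>realizable_root_infinite_height\<close>).
\<close>

section \<open>Homomorphisms on subgroups of an abelian group\<close>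

context comm_group
begin

abbreviation hom_from :: "'a set \<Rightarrow> ('a \<Rightarrow> 'a) set" where
  "hom_from L \<equiv> hom (G\<lparr>carrier := L\<rparr>) G"

lemma hom_fromI:
  assumes "\<And>x. x \<in> L \<Longrightarrow> f x \<in> carrier G"
    and "\<And>x y. x \<in> L \<Longrightarrow> y \<in> L \<Longrightarrow> f (x \<otimes> y) = f x \<otimes> f y"
  shows "f \<in> hom_from L"
  using assms by (auto simp: hom_def)

lemma trivial_hom: "(\<lambda>_. \<one>) \<in> hom_from B"
  by (rule hom_fromI) auto

lemma hom_from_closed: "f \<in> hom_from L \<Longrightarrow> x \<in> L \<Longrightarrow> f x \<in> carrier G"
  by (auto simp: hom_def)

lemma hom_from_mult: "f \<in> hom_from L \<Longrightarrow> x \<in> L \<Longrightarrow> y \<in> L \<Longrightarrow> f (x \<otimes> y) = f x \<otimes> f y"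
  by (auto simp: hom_def)

lemma hom_from_group_hom:
  assumes "f \<in> hom_from L" "subgroup L G"
  shows "group_hom (G\<lparr>carrier := L\<rparr>) G f"
  using assms by (simp add: group_hom_def group_hom_axioms_def subgroup_imp_group)

lemma hom_from_one: "f \<in> hom_from L \<Longrightarrow> subgroup L G \<Longrightarrow> f \<one> = \<one>"
  using group_hom.hom_one[OF hom_from_group_hom] by simp

lemma hom_from_inv: "f \<in> hom_from L \<Longrightarrow> subgroup L G \<Longrightarrow> x \<in> L \<Longrightarrow> f (inv x) = inv (f x)"
  using group_hom.hom_inv[OF hom_from_group_hom, of f L x] by (simp add: m_inv_consistent)

lemma hom_from_pow:
  "f \<in> hom_from L \<Longrightarrow> subgroup L G \<Longrightarrow> x \<in> L \<Longrightarrow> f (x [^] (k::int)) = f x [^] k"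
  using group_hom.hom_int_pow[OF hom_from_group_hom, of f L x k] int_pow_consistent[of L x k] by simp

lemma hom_from_prod:
  assumes "f \<in> hom_from L" "g \<in> hom_from L" "subgroup L G"
  shows "(\<lambda>x. f x \<otimes> g x) \<in> hom_from L"
proof (rule hom_fromI)
  fix x assume "x \<in> L"
  then show "f x \<otimes> g x \<in> carrier G" using assms hom_from_closed by auto
next
  fix x y assume "x \<in> L" "y \<in> L"
  then show "f (x \<otimes> y) \<otimes> g (x \<otimes> y) = f x \<otimes> g x \<otimes> (f y \<otimes> g y)"
    using assms by (simp add: hom_from_mult m_ac hom_from_closed)
qed

lemma hom_from_injI:
  assumes "f \<in> hom_from L" "subgroup L G" "\<And>x. x \<in> L \<Longrightarrow> f x = \<one> \<Longrightarrow> x = \<one>"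
  shows "f \<in> mon (G\<lparr>carrier := L\<rparr>) G"
proof -
  interpret f: group_hom "G\<lparr>carrier := L\<rparr>" G f by (rule hom_from_group_hom[OF assms(1,2)])
  have "inj_on f L" using f.inj_on_one_iff assms(3) by simp
  then show ?thesis using assms(1) by (simp add: mon_def)
qed

lemma endo_hom_from: "subgroup L G \<Longrightarrow> F \<in> hom G G \<Longrightarrow> F \<in> hom_from L"
  using subgroup.mem_carrier by (fastforce simp: hom_def)

lemma endo_prod: "F \<in> hom G G \<Longrightarrow> F' \<in> hom G G \<Longrightarrow> (\<lambda>x. F x \<otimes> F' x) \<in> hom G G"
  using hom_from_prod[of F "carrier G" F'] subgroup_self by simp

lemma endo_inv: "F \<in> hom G G \<Longrightarrow> (\<lambda>x. inv (F x)) \<in> hom G G"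
  by (auto simp: hom_def Pi_def inv_mult)

lemma endo_one: "F \<in> hom G G \<Longrightarrow> F \<one> = \<one>"
  using hom_from_one[of F "carrier G"] subgroup_self by simp

lemma endo_pow: "F \<in> hom G G \<Longrightarrow> x \<in> carrier G \<Longrightarrow> F (x [^] (k::int)) = F x [^] k"
  using hom_from_pow[of F "carrier G"] subgroup_self by simp

definition adjoin :: "'a set \<Rightarrow> 'a \<Rightarrow> 'a set" where
  "adjoin L x = {a \<otimes> x [^] k |a (k::int). a \<in> L}"

lemma adjoinI: "a \<in> L \<Longrightarrow> a \<otimes> x [^] (k::int) \<in> adjoin L x"
  by (auto simp: adjoin_def)

lemma adjoin_subgroup:
  assumes "subgroup L G" "x \<in> carrier G"
  shows "subgroup (adjoin L x) G"
proof (rule subgroupI)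
  interpret L: subgroup L G by fact
  show "adjoin L x \<subseteq> carrier G" using assms by (auto simp: adjoin_def)
  show "adjoin L x \<noteq> {}" using adjoinI[OF L.one_closed] by blast
  show "inv u \<in> adjoin L x" if u: "u \<in> adjoin L x" for u
  proof -
    obtain a k where "u = a \<otimes> x [^] (k::int)" "a \<in> L" using u by (auto simp: adjoin_def)
    then have "inv u = inv a \<otimes> x [^] (-k)" using assms by (simp add: inv_mult int_pow_neg)
    then show ?thesis using adjoinI[of "inv a" L x "-k"] \<open>a \<in> L\<close> by simp
  qed
  show "u \<otimes> v \<in> adjoin L x" if u: "u \<in> adjoin L x" and v: "v \<in> adjoin L x" for u v
  proof -
    obtain a k where a: "u = a \<otimes> x [^] (k::int)" "a \<in> L" using u by (auto simp: adjoin_def)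
    obtain b l where b: "v = b \<otimes> x [^] (l::int)" "b \<in> L" using v by (auto simp: adjoin_def)
    have "u \<otimes> v = (a \<otimes> b) \<otimes> x [^] (k + l)" using a b assms by (simp add: int_pow_mult m_ac)
    then show ?thesis using adjoinI[of "a \<otimes> b" L x "k + l"] a b by simp
  qed
qed

lemma adjoin_incl:
  assumes "subgroup L G" "x \<in> carrier G"
  shows "L \<subseteq> adjoin L x" "x \<in> adjoin L x"
proof -
  interpret L: subgroup L G by fact
  show "L \<subseteq> adjoin L x" using adjoinI[of _ L x 0] by force
  show "x \<in> adjoin L x" using adjoinI[OF L.one_closed, of x 1] assms by simp
qed

lemma adjoin_subset:
  "subgroup M G \<Longrightarrow> L \<subseteq> M \<Longrightarrow> x \<in> M \<Longrightarrow> adjoin L x \<subseteq> M"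
  by (auto simp: adjoin_def subgroup_int_pow_closed subgroup.m_closed)

text \<open>The condition on \<open>x\<close> and \<open>w\<close> is exactly what makes the value \<open>\<phi> a \<otimes> w [^] k\<close> independent of the way
  an element is written as \<open>a \<otimes> x [^] k\<close>.\<close>

lemma hom_extend_one:
  assumes L: "subgroup L G" and \<phi>: "\<phi> \<in> hom_from L"
    and x: "x \<in> carrier G" and w: "w \<in> carrier G"
    and compat: "\<And>k::int. x [^] k \<in> L \<Longrightarrow> \<phi> (x [^] k) = w [^] k"
  obtains \<psi> where "\<psi> \<in> hom_from (adjoin L x)"
    "\<And>a k. a \<in> L \<Longrightarrow> \<psi> (a \<otimes> x [^] (k::int)) = \<phi> a \<otimes> w [^] k"
    "\<And>a. a \<in> L \<Longrightarrow> \<psi> a = \<phi> a" "\<psi> x = w"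
proof -
  interpret L: subgroup L G by fact
  define \<psi> where "\<psi> u = (SOME v. \<exists>a k. a \<in> L \<and> u = a \<otimes> x [^] (k::int) \<and> v = \<phi> a \<otimes> w [^] k)" for u
  have \<psi>: "\<psi> (a \<otimes> x [^] k) = \<phi> a \<otimes> w [^] k" if a: "a \<in> L" for a and k :: int
    unfolding \<psi>_def
  proof (rule some_equality)
    show "\<exists>a' k'. a' \<in> L \<and> a \<otimes> x [^] k = a' \<otimes> x [^] (k'::int) \<and> \<phi> a \<otimes> w [^] k = \<phi> a' \<otimes> w [^] k'"
      using a by blast
  next
    fix v assume "\<exists>b l. b \<in> L \<and> a \<otimes> x [^] k = b \<otimes> x [^] (l::int) \<and> v = \<phi> b \<otimes> w [^] l"
    then obtain b l where b: "b \<in> L" "a \<otimes> x [^] k = b \<otimes> x [^] (l::int)" "v = \<phi> b \<otimes> w [^] l"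
      by blast
    have "x [^] (l - k) = inv b \<otimes> (b \<otimes> x [^] l) \<otimes> inv (x [^] k)"
      using b(1) x by (simp add: int_pow_diff m_assoc[symmetric])
    also have "\<dots> = inv b \<otimes> a"
      using a b(1) x by (simp add: b(2)[symmetric] m_assoc)
    finally have e: "x [^] (l - k) = inv b \<otimes> a" .
    then have "w [^] (l - k) = \<phi> (inv b \<otimes> a)" using compat[of "l - k"] a b(1) by simp
    then have e2: "w [^] l \<otimes> inv (w [^] k) = inv (\<phi> b) \<otimes> \<phi> a"
      using a b(1) by (simp add: hom_from_mult[OF \<phi>] hom_from_inv[OF \<phi> L] int_pow_diff w)
    have c: "\<phi> a \<in> carrier G" "\<phi> b \<in> carrier G" "w [^] l \<in> carrier G" "w [^] k \<in> carrier G"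
      using a b(1) w hom_from_closed[OF \<phi>] by auto
    have "v = \<phi> b \<otimes> (w [^] l \<otimes> inv (w [^] k)) \<otimes> w [^] k"
      using b(3) c by (simp add: m_assoc)
    also have "\<dots> = \<phi> a \<otimes> w [^] k"
      unfolding e2 using c by (simp add: m_assoc[symmetric])
    finally show "v = \<phi> a \<otimes> w [^] k" .
  qed
  have "\<psi> \<in> hom_from (adjoin L x)"
  proof (rule hom_fromI)
    fix u assume "u \<in> adjoin L x"
    then show "\<psi> u \<in> carrier G" using \<psi> hom_from_closed[OF \<phi>] w by (auto simp: adjoin_def)
  next
    fix u v assume "u \<in> adjoin L x" "v \<in> adjoin L x"
    then obtain a k b l where a: "u = a \<otimes> x [^] (k::int)" "a \<in> L"
      and b: "v = b \<otimes> x [^] (l::int)" "b \<in> L" by (auto simp: adjoin_def)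
    have "u \<otimes> v = (a \<otimes> b) \<otimes> x [^] (k + l)" using a b x by (simp add: int_pow_mult m_ac)
    then have "\<psi> (u \<otimes> v) = \<phi> (a \<otimes> b) \<otimes> w [^] (k + l)" using \<psi> a b by simp
    also have "\<dots> = \<psi> u \<otimes> \<psi> v"
      using a b w hom_from_closed[OF \<phi>] by (simp add: \<psi> hom_from_mult[OF \<phi>] int_pow_mult m_ac)
    finally show "\<psi> (u \<otimes> v) = \<psi> u \<otimes> \<psi> v" .
  qed
  moreover have "\<psi> a = \<phi> a" if "a \<in> L" for a
    using \<psi>[OF that, of 0] that hom_from_closed[OF \<phi>] by simp
  moreover have "\<psi> x = w"
    using \<psi>[OF L.one_closed, of 1] x w hom_from_one[OF \<phi> L] by simp
  ultimately show thesis using that \<psi> by blast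
qed

section \<open>Extending homomorphisms into a primary group\<close>

text \<open>The usual Zorn argument for injectivity of divisible groups, with divisibility replaced by the
  existence of the roots that are met on the way. Only \<open>p\<close>-th roots have to be supplied: for a prime
  \<open>q\<close> other than \<open>p\<close>, every element of \<open>K\<close> is a \<open>q\<close>-th power of a power of itself. The same
  statement then serves both for divisible \<open>K\<close> and for cyclic \<open>K\<close>, where the roots come from a bound on
  the exponent.\<close>

lemma extend_into_p_group:
  fixes p :: int
  assumes M: "subgroup M G" and K: "subgroup K G" and L\<^sub>0: "subgroup L\<^sub>0 G" "L\<^sub>0 \<subseteq> M"
    and \<phi>\<^sub>0: "\<phi>\<^sub>0 \<in> hom_from L\<^sub>0" "\<phi>\<^sub>0 ` L\<^sub>0 \<subseteq> K" and p: "prime p"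
    and primary: "\<And>v. v \<in> K \<Longrightarrow> \<exists>k::nat. v [^] (p ^ k) = \<one>"
    and root: "\<And>L \<phi> x. \<lbrakk>subgroup L G; L\<^sub>0 \<subseteq> L; L \<subseteq> M; \<phi> \<in> hom_from L; \<phi> ` L \<subseteq> K;
        \<And>a. a \<in> L\<^sub>0 \<Longrightarrow> \<phi> a = \<phi>\<^sub>0 a; x \<in> M; x [^] p \<in> L\<rbrakk> \<Longrightarrow> \<exists>w\<in>K. w [^] p = \<phi> (x [^] p)"
  obtains \<psi> where "\<psi> \<in> hom_from M" "\<psi> ` M \<subseteq> K" "\<And>a. a \<in> L\<^sub>0 \<Longrightarrow> \<psi> a = \<phi>\<^sub>0 a"
proof -
  interpret M: subgroup M G by fact
  interpret K: subgroup K G by fact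
  \<comment> \<open>Partial homomorphisms are ordered by inclusion of their graphs.\<close>
  define partial where "partial L \<phi> \<longleftrightarrow> subgroup L G \<and> L\<^sub>0 \<subseteq> L \<and> L \<subseteq> M \<and> \<phi> \<in> hom_from L
    \<and> \<phi> ` L \<subseteq> K \<and> (\<forall>a\<in>L\<^sub>0. \<phi> a = \<phi>\<^sub>0 a)" for L \<phi>
  define graph where "graph L \<phi> = (\<lambda>x. (x, \<phi> x)) ` L" for L :: "'a set" and \<phi> :: "'a \<Rightarrow> 'a"
  define A where "A = {graph L \<phi> |L \<phi>. partial L \<phi>}"
  have "\<exists>R\<in>A. \<forall>X\<in>A. R \<subseteq> X \<longrightarrow> X = R"
  proof (rule subset_Zorn_nonempty)
    show "A \<noteq> {}" using L\<^sub>0 \<phi>\<^sub>0 by (auto simp: A_def partial_def)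
    fix C assume ne: "C \<noteq> {}" and C: "subset.chain A C"
    have CA: "\<exists>L \<phi>. R = graph L \<phi> \<and> partial L \<phi>" if "R \<in> C" for R
      using C that by (auto simp: A_def subset_chain_def)
    \<comment> \<open>Any two members of the union already lie in one graph of the chain.\<close>
    have common: "\<exists>L \<phi>. graph L \<phi> \<in> C \<and> partial L \<phi> \<and> r \<in> graph L \<phi> \<and> r' \<in> graph L \<phi>"
      if r: "r \<in> \<Union>C" "r' \<in> \<Union>C" for r r'
    proof -
      obtain R R' where R: "R \<in> C" "R' \<in> C" "r \<in> R" "r' \<in> R'" using r by blast
      then have "R \<subseteq> R' \<or> R' \<subseteq> R" using C by (auto simp: subset_chain_def)
      then obtain R'' where "R'' \<in> C" "r \<in> R''" "r' \<in> R''" using R by blast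
      then show ?thesis using CA by metis
    qed
    define D where "D = fst ` \<Union>C"
    have single: "v = w" if "(x, v) \<in> \<Union>C" "(x, w) \<in> \<Union>C" for x v w
      using common[OF that] by (auto simp: graph_def)
    define \<phi> where "\<phi> x = (THE v. (x, v) \<in> \<Union>C)" for x
    have \<phi>: "\<phi> x = v" if "(x, v) \<in> \<Union>C" for x v
      unfolding \<phi>_def using that single by (intro the_equality) blast+
    have UC: "\<Union>C = graph D \<phi>"
    proof
      show "\<Union>C \<subseteq> graph D \<phi>" using \<phi> by (force simp: graph_def D_def)
      show "graph D \<phi> \<subseteq> \<Union>C"
      proof
        fix r assume "r \<in> graph D \<phi>"
        then obtain x where x: "r = (x, \<phi> x)" "x \<in> D" by (auto simp: graph_def)
        then obtain r' where "r' \<in> \<Union>C" "x = fst r'" unfolding D_def by blast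
        then have "(x, snd r') \<in> \<Union>C" by simp
        then show "r \<in> \<Union>C" using \<phi>[of x "snd r'"] x(1) by simp
      qed
    qed
    have mem_D: "x \<in> D" if "(x, v) \<in> \<Union>C" for x v using that unfolding D_def by (metis fst_conv image_eqI)
    have mem: "(x, \<phi> x) \<in> \<Union>C" if "x \<in> D" for x using that unfolding UC graph_def by blast
    \<comment> \<open>Hence \<open>\<phi>\<close> inherits every property that concerns at most two elements at a time.\<close>
    have local: "\<exists>L \<xi>. L \<subseteq> D \<and> partial L \<xi> \<and> x \<in> L \<and> y \<in> L \<and> (\<forall>z\<in>L. \<phi> z = \<xi> z)"
      if xy: "x \<in> D" "y \<in> D" for x y
    proof -
      obtain L \<xi> where L: "graph L \<xi> \<in> C" "partial L \<xi>" "(x, \<phi> x) \<in> graph L \<xi>" "(y, \<phi> y) \<in> graph L \<xi>"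
        using common[OF mem[OF xy(1)] mem[OF xy(2)]] by blast
      have "(z, \<xi> z) \<in> \<Union>C" if "z \<in> L" for z using L(1) that unfolding graph_def by blast
      then have "\<phi> z = \<xi> z" "z \<in> D" if "z \<in> L" for z using that \<phi> mem_D by blast+
      moreover have "x \<in> L" "y \<in> L" using L(3,4) by (auto simp: graph_def)
      ultimately show ?thesis using L(2) by blast
    qed
    obtain R where "R \<in> C" using ne by blast
    then obtain L \<xi> where L: "R = graph L \<xi>" "partial L \<xi>" using CA by blast
    have "x \<in> D" if "x \<in> L" for x
      using that L(1) \<open>R \<in> C\<close> unfolding graph_def by (intro mem_D[of x "\<xi> x"]) blast
    then have L\<^sub>0D: "L\<^sub>0 \<subseteq> D" using L(2) by (auto simp: partial_def)
    have "D \<subseteq> M" "\<phi> ` D \<subseteq> K" "\<forall>a\<in>L\<^sub>0. \<phi> a = \<phi>\<^sub>0 a"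
    proof -
      have "x \<in> M \<and> \<phi> x \<in> K \<and> (x \<in> L\<^sub>0 \<longrightarrow> \<phi> x = \<phi>\<^sub>0 x)" if x: "x \<in> D" for x
      proof -
        obtain L \<xi> where "partial L \<xi>" "x \<in> L" "\<forall>z\<in>L. \<phi> z = \<xi> z" using local[OF x x] by blast
        then show ?thesis unfolding partial_def by auto
      qed
      then show "D \<subseteq> M" "\<phi> ` D \<subseteq> K" "\<forall>a\<in>L\<^sub>0. \<phi> a = \<phi>\<^sub>0 a" using L\<^sub>0D by blast+
    qed
    moreover have "subgroup D G"
    proof (rule subgroupI)
      show "D \<subseteq> carrier G" using \<open>D \<subseteq> M\<close> M.subset by blast
      show "D \<noteq> {}" using L\<^sub>0D subgroup.one_closed[OF L\<^sub>0(1)] by blast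
      show "inv x \<in> D" if x: "x \<in> D" for x
      proof -
        obtain L \<xi> where "L \<subseteq> D" "partial L \<xi>" "x \<in> L" using local[OF x x] by blast
        moreover from this have "subgroup L G" by (simp add: partial_def)
        ultimately show ?thesis by (meson subgroup.m_inv_closed subsetD)
      qed
      show "x \<otimes> y \<in> D" if xy: "x \<in> D" "y \<in> D" for x y
      proof -
        obtain L \<xi> where "L \<subseteq> D" "partial L \<xi>" "x \<in> L" "y \<in> L" using local[OF xy] by blast
        moreover from this have "subgroup L G" by (simp add: partial_def)
        ultimately show ?thesis by (meson subgroup.m_closed subsetD)
      qed
    qed
    moreover have "\<phi> \<in> hom_from D"
    proof (rule hom_fromI)
      show "\<phi> x \<in> carrier G" if "x \<in> D" for x using that \<open>\<phi> ` D \<subseteq> K\<close> K.subset by blast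
      show "\<phi> (x \<otimes> y) = \<phi> x \<otimes> \<phi> y" if xy: "x \<in> D" "y \<in> D" for x y
      proof -
        obtain L \<xi> where L: "partial L \<xi>" "x \<in> L" "y \<in> L" "\<forall>z\<in>L. \<phi> z = \<xi> z"
          using local[OF xy] by blast
        then have "subgroup L G" "\<xi> \<in> hom_from L" by (simp_all add: partial_def)
        then show ?thesis using L(2-4) hom_from_mult[of \<xi> L x y] subgroup.m_closed[of L G x y] by simp
      qed
    qed
    ultimately have "partial D \<phi>" using L\<^sub>0D by (simp add: partial_def)
    then show "\<Union>C \<in> A" unfolding UC A_def by blast
  qed
  then obtain R where R: "R \<in> A" "\<And>X. X \<in> A \<Longrightarrow> R \<subseteq> X \<Longrightarrow> X = R" by blast
  from R(1) obtain L \<phi> where part: "partial L \<phi>" and R_eq: "R = graph L \<phi>" unfolding A_def by blast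
  have max: "graph L' \<phi>' = graph L \<phi>" if "partial L' \<phi>'" "graph L \<phi> \<subseteq> graph L' \<phi>'" for L' \<phi>'
  proof -
    have "graph L' \<phi>' \<in> A" using that(1) unfolding A_def by blast
    then show ?thesis using R(2) that(2) R_eq by simp
  qed
  have L: "subgroup L G" "L\<^sub>0 \<subseteq> L" "L \<subseteq> M" "\<phi> \<in> hom_from L" "\<phi> ` L \<subseteq> K"
    and agree: "\<And>a. a \<in> L\<^sub>0 \<Longrightarrow> \<phi> a = \<phi>\<^sub>0 a"
    using part by (auto simp: partial_def)
  interpret L: subgroup L G by fact
  have no_ext: False
    if x: "x \<in> M" "x \<notin> L" and w: "w \<in> K"
      and compat: "\<And>k::int. x [^] k \<in> L \<Longrightarrow> \<phi> (x [^] k) = w [^] k" for x w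
  proof -
    have xG: "x \<in> carrier G" "w \<in> carrier G" using x w by auto
    obtain \<psi> where \<psi>: "\<psi> \<in> hom_from (adjoin L x)"
      "\<And>a k. a \<in> L \<Longrightarrow> \<psi> (a \<otimes> x [^] (k::int)) = \<phi> a \<otimes> w [^] k"
      "\<And>a. a \<in> L \<Longrightarrow> \<psi> a = \<phi> a" "\<psi> x = w"
      using hom_extend_one[OF L(1) L(4) xG compat] by blast
    have "\<psi> ` adjoin L x \<subseteq> K"
      using \<psi>(2) L(5) subgroup_int_pow_closed[OF K w] by (auto simp: adjoin_def)
    then have "partial (adjoin L x) \<psi>"
      using adjoin_subgroup[OF L(1) xG(1)] adjoin_incl[OF L(1) xG(1)] adjoin_subset[OF M L(3) x(1)]
        \<psi>(1,3) L(2) agree by (auto simp: partial_def)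
    moreover have "graph L \<phi> \<subseteq> graph (adjoin L x) \<psi>"
      using \<psi>(3) adjoin_incl[OF L(1) xG(1)] by (force simp: graph_def)
    ultimately have "graph (adjoin L x) \<psi> = graph L \<phi>" by (rule max)
    then have "fst ` graph (adjoin L x) \<psi> = fst ` graph L \<phi>" by simp
    then have "adjoin L x = L" by (simp add: graph_def image_image)
    then show False using adjoin_incl(2)[OF L(1) xG(1)] x by simp
  qed
  have "M \<subseteq> L"
  proof (rule ccontr)
    assume "\<not> M \<subseteq> L"
    then obtain x\<^sub>0 where x\<^sub>0: "x\<^sub>0 \<in> M" "x\<^sub>0 \<notin> L" by blast
    show False
    proof (cases "\<exists>n>0. x\<^sub>0 [^] int n \<in> L")
      case False
      have "k = 0" if k: "x\<^sub>0 [^] (k::int) \<in> L" for k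
      proof (rule ccontr)
        assume "k \<noteq> 0"
        have "x\<^sub>0 [^] (- k) \<in> L" using k x\<^sub>0 by (simp add: int_pow_neg)
        then have "x\<^sub>0 [^] int (nat \<bar>k\<bar>) \<in> L" using k by (cases "k < 0") auto
        then show False using False \<open>k \<noteq> 0\<close> by (metis zero_less_abs_iff zero_less_nat_eq)
      qed
      then have "\<phi> (x\<^sub>0 [^] k) = \<one> [^] k" if "x\<^sub>0 [^] (k::int) \<in> L" for k
        using that hom_from_one[OF L(4) L(1)] by fastforce
      then show False using no_ext[OF x\<^sub>0 K.one_closed] by blast
    next
      case True
      define n where "n = (LEAST n. 0 < n \<and> x\<^sub>0 [^] int n \<in> L)"
      have n: "0 < n" "x\<^sub>0 [^] int n \<in> L" using LeastI_ex[OF True] by (auto simp: n_def)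
      have least: "n \<le> m" if "0 < m" "x\<^sub>0 [^] int m \<in> L" for m
        unfolding n_def using that by (intro Least_le) simp
      have "n \<noteq> 1" using n(2) x\<^sub>0 by auto
      then obtain q\<^sub>0 where "prime q\<^sub>0" "q\<^sub>0 dvd n" using prime_factor_nat by blast
      then obtain r where r: "n = q\<^sub>0 * r" by (auto elim: dvdE)
      define q where "q = int q\<^sub>0"
      have q: "prime q" using \<open>prime q\<^sub>0\<close> by (simp add: q_def)
      \<comment> \<open>By minimality of \<open>n\<close> the power \<open>x\<close> lies outside \<open>L\<close>, but has prime order modulo \<open>L\<close>.\<close>
      define x where "x = x\<^sub>0 [^] int r"
      have xM: "x \<in> M" using x\<^sub>0 subgroup_int_pow_closed[OF M] by (simp add: x_def)
      have xG: "x \<in> carrier G" using xM by simp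
      have "0 < r" "r < n" using r n(1) prime_gt_1_nat[OF \<open>prime q\<^sub>0\<close>] by (auto intro: Nat.gr0I)
      then have xL: "x \<notin> L" using least[of r] by (auto simp: x_def)
      have "x [^] q = x\<^sub>0 [^] int n" using x\<^sub>0 by (simp add: x_def q_def r int_pow_pow mult.commute)
      then have xq: "x [^] q \<in> L" using n by simp
      have dvd: "q dvd k" if k: "x [^] k \<in> L" for k
      proof (rule ccontr)
        assume "\<not> q dvd k"
        then have "coprime q k" using q by (simp add: prime_imp_coprime)
        then obtain a b where ab: "a * q + b * k = 1" using bezout_int[of q k] by auto
        have "x = x [^] (a * q + b * k)" using xG ab by simp
        also have "\<dots> = (x [^] q) [^] a \<otimes> (x [^] k) [^] b"
          using xG by (simp add: int_pow_mult int_pow_pow mult.commute)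
        also have "\<dots> \<in> L" using xq k L.m_closed subgroup_int_pow_closed[OF L(1)] by simp
        finally show False using xL by simp
      qed
      obtain w where w: "w \<in> K" "w [^] q = \<phi> (x [^] q)"
      proof (cases "q = p")
        case True
        then show thesis using that root[OF L agree xM] xq by auto
      next
        case False
        define v where "v = \<phi> (x [^] q)"
        have v: "v \<in> K" using L(5) xq by (auto simp: v_def)
        then obtain k :: nat where k: "v [^] (p ^ k) = \<one>" using primary by blast
        have "coprime q (p ^ k)" using primes_coprime[OF q p False] by simp
        then obtain a b where ab: "a * q + b * p ^ k = 1" using bezout_int[of q "p ^ k"] by auto
        have "v = v [^] (a * q + b * p ^ k)" using v ab by simp
        also have "\<dots> = (v [^] a) [^] q \<otimes> (v [^] (p ^ k)) [^] b"
          using v by (simp add: int_pow_mult int_pow_pow mult.commute)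
        also have "\<dots> = (v [^] a) [^] q" using v k by simp
        finally show thesis using that[of "v [^] a"] v subgroup_int_pow_closed[OF K] by (simp add: v_def)
      qed
      have "\<phi> (x [^] k) = w [^] k" if k: "x [^] k \<in> L" for k :: int
      proof -
        obtain l where l: "k = q * l" using dvd[OF k] by blast
        have "\<phi> (x [^] k) = \<phi> ((x [^] q) [^] l)" using xG by (simp add: l int_pow_pow)
        also have "\<dots> = (w [^] q) [^] l" by (simp only: hom_from_pow[OF L(4) L(1) xq] w(2))
        also have "\<dots> = w [^] k" using K.mem_carrier[OF w(1)] by (simp add: l int_pow_pow)
        finally show ?thesis .
      qed
      then show False using no_ext[OF xM xL w(1)] by blast
    qed
  qed
  then have "L = M" using L(3) by blast
  then show thesis using that L agree by blast
qed

section \<open>Prime power orders and cyclic targets\<close>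

lemma eq_inv_of_mult_one:
  assumes "x \<in> carrier G" "y \<in> carrier G" "x \<otimes> y = \<one>"
  shows "y = inv x"
  using assms inv_equality[of y x] m_comm[of x y] by simp

lemma pow_dvd_one:
  assumes "x \<in> carrier G" "x [^] (n::int) = \<one>" "n dvd k"
  shows "x [^] k = \<one>"
proof -
  obtain r where "k = n * r" using assms(3) by blast
  then have "x [^] k = (x [^] n) [^] r" using assms(1) by (simp only: int_pow_pow)
  then show ?thesis using assms(2) by simp
qed

lemma gcd_pow_mem:
  assumes "subgroup N G" "x \<in> carrier G" "x [^] (k::int) \<in> N" "x [^] (l::int) \<in> N"
  shows "x [^] gcd k l \<in> N"
proof -
  obtain a b where "a * k + b * l = gcd k l" using bezout_int by blast
  then have "x [^] gcd k l = (x [^] k) [^] a \<otimes> (x [^] l) [^] b"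
    using assms(2) by (simp add: int_pow_mult[symmetric] int_pow_pow mult.commute)
  then show ?thesis using assms by (simp add: subgroup.m_closed subgroup_int_pow_closed)
qed

text \<open>The exponents \<open>k\<close> with \<open>x [^] k\<close> in \<open>N\<close> form an ideal that contains \<open>p ^ Suc e\<close> but not \<open>p ^ e\<close>, so it is
  generated by \<open>p ^ Suc e\<close>.\<close>

lemma prime_power_order_dvd:
  assumes N: "subgroup N G" and x: "x \<in> carrier G" and p: "prime (p::int)"
    and ord: "x [^] (p ^ Suc e) \<in> N" "x [^] (p ^ e) \<notin> N" and k: "x [^] (k::int) \<in> N"
  shows "p ^ Suc e dvd k"
proof -
  obtain i where i: "i \<le> Suc e" "gcd k (p ^ Suc e) = p ^ i"
    using divides_primepow[OF p, of "gcd k (p ^ Suc e)" "Suc e"] by auto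
  have mem: "x [^] (p ^ i) \<in> N" using gcd_pow_mem[OF N x k ord(1)] i by simp
  have "i = Suc e"
  proof (rule ccontr)
    assume "i \<noteq> Suc e"
    then have "x [^] (p ^ e) = (x [^] (p ^ i)) [^] (p ^ (e - i))"
      using i x by (simp add: int_pow_pow power_add[symmetric])
    then show False using mem ord(2) subgroup_int_pow_closed[OF N] by simp
  qed
  then show ?thesis using i by (metis gcd_dvd1)
qed

text \<open>The subgroups of a cyclic \<open>p\<close>-group form a chain, so its subgroup of order \<open>p\<close> lies in every
  nontrivial subgroup.\<close>

lemma power_in_socle:
  assumes y: "y \<in> carrier G" and p: "prime (p::int)" and one: "y [^] (p ^ Suc m) = \<one>"
    and l: "y [^] (l::int) \<noteq> \<one>"
  shows "\<exists>q::int. (y [^] l) [^] q = y [^] (p ^ m)"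
proof -
  obtain i where i: "i \<le> Suc m" "gcd l (p ^ Suc m) = p ^ i"
    using divides_primepow[OF p, of "gcd l (p ^ Suc m)" "Suc m"] by auto
  obtain a b where ab: "a * l + b * p ^ Suc m = p ^ i" using bezout_int i(2) by metis
  have "y [^] (p ^ i) = (y [^] l) [^] a \<otimes> (y [^] (p ^ Suc m)) [^] b"
    using y ab by (simp only: int_pow_mult[symmetric] int_pow_pow mult.commute)
  then have yi: "y [^] (p ^ i) = (y [^] l) [^] a" using y one by simp
  have "i \<noteq> Suc m"
  proof
    assume "i = Suc m"
    then obtain r where "l = p ^ Suc m * r" using i(2) by (metis gcd_dvd1 dvdE)
    then have "y [^] l = (y [^] (p ^ Suc m)) [^] r" using y by (simp only: int_pow_pow)
    then show False using l one by simp
  qed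
  then have "y [^] (p ^ m) = (y [^] (p ^ i)) [^] (p ^ (m - i))"
    using i y by (simp add: int_pow_pow power_add[symmetric])
  also have "\<dots> = (y [^] l) [^] (a * p ^ (m - i))" using y by (simp add: yi int_pow_pow mult.assoc)
  finally show ?thesis by metis
qed

lemma pow_image_subgroup:
  assumes "subgroup M G"
  shows "subgroup ((\<lambda>x. x [^] (n::int)) ` M) G"
proof (rule subgroupI)
  interpret M: subgroup M G by fact
  show "(\<lambda>x. x [^] n) ` M \<subseteq> carrier G" by auto
  show "(\<lambda>x. x [^] n) ` M \<noteq> {}" using M.one_closed by blast
  show "inv a \<in> (\<lambda>x. x [^] n) ` M" if "a \<in> (\<lambda>x. x [^] n) ` M" for a
    using that M.m_inv_closed by (auto simp: int_pow_inv[symmetric])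
  show "a \<otimes> b \<in> (\<lambda>x. x [^] n) ` M" if "a \<in> (\<lambda>x. x [^] n) ` M" "b \<in> (\<lambda>x. x [^] n) ` M" for a b
    using that M.m_closed by (auto simp: int_pow_distrib[symmetric])
qed

lemma cyclic_subgroup: "y \<in> carrier G \<Longrightarrow> subgroup (range (\<lambda>l::int. y [^] l)) G"
  using adjoin_subgroup[OF triv_subgroup, of y] by (simp add: adjoin_def full_SetCompr_eq)

text \<open>Modulo \<open>N\<close> the group \<open>M\<close> has exponent dividing \<open>p ^ Suc m\<close>, and the cyclic group \<open>\<langle>y\<rangle>\<close> of order
  \<open>p ^ Suc m\<close> is injective among the groups with that property. Hence the obvious embedding of the
  cyclic subgroup generated by \<open>d\<close> modulo \<open>N\<close> extends to \<open>M\<close>.\<close>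

lemma cyclic_character:
  fixes p :: int
  assumes M: "subgroup M G" and N: "subgroup N G" "N \<subseteq> M" and p: "prime p"
    and pow: "\<And>x. x \<in> M \<Longrightarrow> x [^] (p ^ Suc m) \<in> N"
    and d: "d \<in> M" "d [^] (p ^ Suc e) \<in> N" "d [^] (p ^ e) \<notin> N" "e \<le> m"
    and y: "y \<in> carrier G" "y [^] (p ^ Suc m) = \<one>" "y [^] (p ^ m) \<noteq> \<one>"
  obtains \<psi> where "\<psi> \<in> hom_from M" "\<psi> ` M \<subseteq> range (\<lambda>l::int. y [^] l)"
    "\<And>a. a \<in> N \<Longrightarrow> \<psi> a = \<one>" "\<psi> d = y [^] (p ^ (m - e))"
proof -
  interpret M: subgroup M G by fact
  define w where "w = y [^] (p ^ (m - e))"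
  have w: "w \<in> carrier G" using y by (simp add: w_def)
  have dG: "d \<in> carrier G" using d by simp
  have "m - e + Suc e = Suc m" using d(4) by simp
  then have "w [^] (p ^ Suc e) = y [^] (p ^ Suc m)"
    using y(1) by (simp only: w_def int_pow_pow power_add[symmetric])
  then have "\<one> = w [^] k" if k: "d [^] k \<in> N" for k :: int
    using pow_dvd_one[OF w _ prime_power_order_dvd[OF N(1) dG p d(2,3) k]] y(2) by simp
  then obtain \<phi> where \<phi>: "\<phi> \<in> hom_from (adjoin N d)"
    "\<And>a k. a \<in> N \<Longrightarrow> \<phi> (a \<otimes> d [^] (k::int)) = \<one> \<otimes> w [^] k"
    "\<And>a. a \<in> N \<Longrightarrow> \<phi> a = \<one>" "\<phi> d = w"
    using hom_extend_one[OF N(1) trivial_hom dG w] by metis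
  let ?K = "range (\<lambda>l::int. y [^] l)"
  have K: "subgroup ?K G" using y cyclic_subgroup by simp
  have wK: "w [^] k \<in> ?K" for k :: int using y by (auto simp: w_def int_pow_pow)
  have "\<phi> ` adjoin N d \<subseteq> ?K" using \<phi>(2) wK w by (auto simp: adjoin_def)
  have ad: "subgroup (adjoin N d) G" "adjoin N d \<subseteq> M" "N \<subseteq> adjoin N d" "d \<in> adjoin N d"
    using adjoin_subgroup[OF N(1) dG] adjoin_subset[OF M N(2) d(1)] adjoin_incl[OF N(1) dG] by auto
  obtain \<psi> where \<psi>: "\<psi> \<in> hom_from M" "\<psi> ` M \<subseteq> ?K" "\<And>a. a \<in> adjoin N d \<Longrightarrow> \<psi> a = \<phi> a"
    \<comment> \<open>A value \<open>y [^] l\<close> taken at a \<open>p\<close>-th power is killed by \<open>p ^ m\<close>, which forces \<open>p\<close> to divide \<open>l\<close>.\<close>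
  proof (rule extend_into_p_group[OF M K ad(1,2) \<phi>(1) \<open>\<phi> ` adjoin N d \<subseteq> ?K\<close> p])
    fix v assume "v \<in> ?K"
    then obtain l :: int where "v = y [^] l" by blast
    then have "v [^] (p ^ Suc m) = y [^] (l * p ^ Suc m)" using y(1) by (simp only: int_pow_pow)
    then have "v [^] (p ^ Suc m) = \<one>" using pow_dvd_one[OF y(1,2) dvd_triv_right] by simp
    then show "\<exists>k::nat. v [^] (p ^ k) = \<one>" by blast
  next
    fix L \<xi> x
    assume L: "subgroup L G" "adjoin N d \<subseteq> L" "\<xi> \<in> hom_from L" "\<xi> ` L \<subseteq> ?K"
      and agree: "\<And>a. a \<in> adjoin N d \<Longrightarrow> \<xi> a = \<phi> a" and x: "x \<in> M" "x [^] p \<in> L"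
    obtain l :: int where l: "\<xi> (x [^] p) = y [^] l" using L(4) x(2) by blast
    have xp: "(x [^] p) [^] (p ^ m) = x [^] (p ^ Suc m)" using x by (simp add: int_pow_pow)
    have "y [^] (l * p ^ m) = \<xi> (x [^] p) [^] (p ^ m)" using y by (simp add: l int_pow_pow)
    also have "\<dots> = \<xi> (x [^] (p ^ Suc m))" by (simp only: xp[symmetric] hom_from_pow[OF L(3,1) x(2)])
    also have "\<dots> = \<phi> (x [^] (p ^ Suc m))" using agree ad(3) pow[OF x(1)] by (meson subsetD)
    also have "\<dots> = \<one>" by (rule \<phi>(3)[OF pow[OF x(1)]])
    finally have "y [^] (l * p ^ m) \<in> {\<one>}" by simp
    moreover have "y [^] (p ^ Suc m) \<in> {\<one>}" "y [^] (p ^ m) \<notin> {\<one>}" using y(2,3) by auto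
    ultimately have "p ^ Suc m dvd l * p ^ m"
      using prime_power_order_dvd[OF triv_subgroup y(1) p] by blast
    then have "p dvd l" using prime_gt_0_int[OF p] by simp
    then obtain r where "l = p * r" by blast
    then have "(y [^] r) [^] p = \<xi> (x [^] p)" using y(1) unfolding l by (simp add: int_pow_pow mult.commute)
    then show "\<exists>w\<in>?K. w [^] p = \<xi> (x [^] p)" by blast
  qed (rule that)
  have "\<psi> a = \<one>" if "a \<in> N" for a using that \<psi>(3) \<phi>(3) ad(3) by (metis subsetD)
  moreover have "\<psi> d = y [^] (p ^ (m - e))" using \<psi>(3)[OF ad(4)] \<phi>(4) by (simp add: w_def)
  ultimately show thesis using that[OF \<psi>(1,2)] by blast
qed

section \<open>The divisible part of high powers\<close>

text \<open>A \<open>p\<close>-group is divisible as soon as every element of order \<open>p\<close> has infinite height. The finiteness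
  hypothesis makes the socles of the groups of \<open>p ^ n\<close>-th powers stabilize at some \<open>n\<^sub>0\<close>, so that this
  criterion applies to the \<open>p\<close>-torsion elements among the \<open>p ^ n\<^sub>0\<close>-th powers.\<close>

lemma divisible_part:
  fixes p :: int
  assumes p: "prime p"
    and fin: "finite {t \<in> carrier G. t [^] p = \<one> \<and> (\<exists>x\<in>carrier G. t = x [^] (p ^ n\<^sub>1))}"
  obtains D n\<^sub>0 where "subgroup D G" "\<And>v. v \<in> D \<Longrightarrow> \<exists>k::nat. v [^] (p ^ k) = \<one>"
    "\<And>v. v \<in> D \<Longrightarrow> \<exists>w\<in>D. w [^] p = v"
    "\<And>x k. x \<in> carrier G \<Longrightarrow> x [^] (p ^ k) = \<one> \<Longrightarrow> x [^] (p ^ n\<^sub>0) \<in> D"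
proof -
  define T where "T n = {t \<in> carrier G. t [^] p = \<one> \<and> (\<exists>x\<in>carrier G. t = x [^] (p ^ n))}" for n
  have anti: "T (n + k) \<subseteq> T n" for n k
  proof
    fix t assume t: "t \<in> T (n + k)"
    then obtain x where x: "x \<in> carrier G" "t = x [^] (p ^ (n + k))" by (auto simp: T_def)
    then have "t = (x [^] (p ^ k)) [^] (p ^ n)" by (simp add: int_pow_pow power_add mult.commute)
    then show "t \<in> T n" using t x(1) by (auto simp: T_def)
  qed
  obtain j where j: "\<And>i. card (T (n\<^sub>1 + j)) \<le> card (T (n\<^sub>1 + i))"
    using ex_has_least_nat[of "\<lambda>_. True" 0 "\<lambda>i. card (T (n\<^sub>1 + i))"] by auto
  define n\<^sub>0 where "n\<^sub>0 = n\<^sub>1 + j"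
  have stable: "T (n\<^sub>0 + k) = T n\<^sub>0" for k
  proof (rule card_seteq)
    show "finite (T n\<^sub>0)" using finite_subset[OF anti[of n\<^sub>1 j]] fin by (simp add: T_def n\<^sub>0_def)
    show "card (T n\<^sub>0) \<le> card (T (n\<^sub>0 + k))" using j[of "j + k"] by (simp add: n\<^sub>0_def add.assoc)
  qed (rule anti)
  define D where "D = {v \<in> carrier G. (\<exists>k::nat. v [^] (p ^ k) = \<one>)} \<inter> (\<lambda>x. x [^] (p ^ n\<^sub>0)) ` carrier G"
  have "subgroup {v \<in> carrier G. (\<exists>k::nat. v [^] (p ^ k) = \<one>)} G"
  proof (rule subgroupI)
    show "{v \<in> carrier G. \<exists>k::nat. v [^] (p ^ k) = \<one>} \<noteq> {}" using int_pow_one by blast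
    show "inv a \<in> {v \<in> carrier G. \<exists>k::nat. v [^] (p ^ k) = \<one>}"
      if "a \<in> {v \<in> carrier G. \<exists>k::nat. v [^] (p ^ k) = \<one>}" for a
      using that by (auto simp: int_pow_inv)
    fix a b assume "a \<in> {v \<in> carrier G. \<exists>k::nat. v [^] (p ^ k) = \<one>}"
      and "b \<in> {v \<in> carrier G. \<exists>k::nat. v [^] (p ^ k) = \<one>}"
    then obtain k l :: nat where a: "a \<in> carrier G" "a [^] (p ^ k) = \<one>"
      and b: "b \<in> carrier G" "b [^] (p ^ l) = \<one>" by blast
    have "(a \<otimes> b) [^] (p ^ (k + l)) = (a [^] (p ^ k)) [^] (p ^ l) \<otimes> (b [^] (p ^ l)) [^] (p ^ k)"
      using a(1) b(1) by (simp add: int_pow_distrib int_pow_pow power_add mult.commute)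
    also have "\<dots> = \<one>" using a b by simp
    finally show "a \<otimes> b \<in> {v \<in> carrier G. \<exists>k::nat. v [^] (p ^ k) = \<one>}" using a b by blast
  qed auto
  then have D: "subgroup D G"
    unfolding D_def using pow_image_subgroup[OF subgroup_self] by (rule subgroups_Inter_pair)
  have high: "x [^] (p ^ n\<^sub>0) \<in> D" if x: "x \<in> carrier G" "x [^] (p ^ k) = \<one>" for x k
  proof -
    have "(x [^] (p ^ n\<^sub>0)) [^] (p ^ k) = (x [^] (p ^ k)) [^] (p ^ n\<^sub>0)"
      using x(1) by (simp add: int_pow_pow mult.commute)
    then have "(x [^] (p ^ n\<^sub>0)) [^] (p ^ k) = \<one>" using x by simp
    then show ?thesis unfolding D_def using x(1) by blast
  qed
  have root: "\<exists>w\<in>D. w [^] p = v [^] (p ^ n\<^sub>0)"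
    if "v \<in> carrier G" "(v [^] (p ^ n\<^sub>0)) [^] (p ^ k) = \<one>" for v k
    using that
  proof (induction k arbitrary: v)
    case 0
    then have "\<one> [^] p = v [^] (p ^ n\<^sub>0)" by simp
    then show ?case using subgroup.one_closed[OF D] by blast
  next
    case (Suc k)
    define x where "x = v [^] (p ^ n\<^sub>0)"
    define t where "t = x [^] (p ^ k)"
    have xG: "x \<in> carrier G" and tG: "t \<in> carrier G" using Suc.prems by (auto simp: x_def t_def)
    have "t [^] p = \<one>" using Suc.prems xG by (simp add: t_def int_pow_pow mult.commute x_def[symmetric])
    moreover have "t = (v [^] (p ^ k)) [^] (p ^ n\<^sub>0)"
      using Suc.prems(1) by (simp add: t_def x_def int_pow_pow mult.commute)
    ultimately have "t \<in> T n\<^sub>0" using Suc.prems(1) tG by (auto simp: T_def)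
    then have "t \<in> T (n\<^sub>0 + Suc k)" using stable[of "Suc k"] by blast
    then obtain u where u: "u \<in> carrier G" "t = u [^] (p ^ (n\<^sub>0 + Suc k))" by (auto simp: T_def)
    \<comment> \<open>As \<open>t\<close> is also reached from \<open>u [^] p\<close> by the exponent \<open>p ^ (n\<^sub>0 + k)\<close>, dividing \<open>v\<close> by \<open>u [^] p\<close>
      removes \<open>t\<close> and lowers the order.\<close>
    have "u [^] (p ^ (n\<^sub>0 + Suc k + 1)) = \<one>"
      using \<open>t [^] p = \<one>\<close> u by (simp add: int_pow_pow mult.commute)
    then have aD: "u [^] (p ^ n\<^sub>0) \<in> D" using high u(1) by blast
    define v' where "v' = v \<otimes> inv (u [^] p)"
    have v'G: "v' \<in> carrier G" using Suc.prems u by (simp add: v'_def)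
    have up: "((u [^] p) [^] (p ^ n\<^sub>0)) [^] (p ^ k) = t"
      using u by (simp add: int_pow_pow power_add mult_ac)
    have v'x: "v' [^] (p ^ n\<^sub>0) = x \<otimes> inv ((u [^] p) [^] (p ^ n\<^sub>0))"
      using Suc.prems(1) u(1) by (simp add: v'_def x_def int_pow_distrib int_pow_inv)
    then have "(v' [^] (p ^ n\<^sub>0)) [^] (p ^ k) = t \<otimes> inv t"
      using xG u(1) up by (simp add: int_pow_distrib int_pow_inv t_def)
    then have "(v' [^] (p ^ n\<^sub>0)) [^] (p ^ k) = \<one>" using tG by simp
    then obtain w where w: "w \<in> D" "w [^] p = v' [^] (p ^ n\<^sub>0)" using Suc.IH[OF v'G] by blast
    have wG: "w \<in> carrier G" using w(1) subgroup.mem_carrier[OF D] by blast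
    have "(w \<otimes> u [^] (p ^ n\<^sub>0)) [^] p = v' [^] (p ^ n\<^sub>0) \<otimes> (u [^] p) [^] (p ^ n\<^sub>0)"
      using wG u(1) w(2) by (simp add: int_pow_distrib int_pow_pow mult.commute)
    also have "\<dots> = x" unfolding v'x using xG u(1) by (simp add: m_assoc)
    finally show ?case using subgroup.m_closed[OF D w(1) aD] by (auto simp: x_def)
  qed
  have "\<exists>w\<in>D. w [^] p = v" if "v \<in> D" for v
    using that root unfolding D_def by blast
  moreover have "\<exists>k::nat. v [^] (p ^ k) = \<one>" if "v \<in> D" for v
    using that unfolding D_def by blast
  ultimately show thesis using that[OF D] high by blast
qed

end

section \<open>Realizing one coordinate of a direct decomposition\<close>

locale mono_extending = comm_group G for G (structure) +
  fixes H
  assumes H: "subgroup H G"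
    and mono_extends: "u \<in> mon (G\<lparr>carrier := H\<rparr>) G \<Longrightarrow> extends_to_endo G H u"
begin

text \<open>The homomorphisms that extend form a group, and this group contains all monomorphisms.\<close>

lemma difference_extends:
  assumes u: "u \<in> mon (G\<lparr>carrier := H\<rparr>) G" and f: "f \<in> hom_from H"
    and inj: "\<And>h. h \<in> H \<Longrightarrow> u h \<otimes> f h = \<one> \<Longrightarrow> h = \<one>"
  shows "\<exists>F\<in>hom G G. \<forall>h\<in>H. F h = f h"
proof -
  have uh: "u \<in> hom_from H" using u by (simp add: mon_def)
  have "(\<lambda>h. u h \<otimes> f h) \<in> mon (G\<lparr>carrier := H\<rparr>) G"
    using hom_from_injI[OF hom_from_prod[OF uh f H] H] inj by blast
  then obtain F1 where F1: "F1 \<in> hom G G" "\<And>h. h \<in> H \<Longrightarrow> F1 h = u h \<otimes> f h"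
    using mono_extends unfolding extends_to_endo_def by blast
  obtain F2 where F2: "F2 \<in> hom G G" "\<And>h. h \<in> H \<Longrightarrow> F2 h = u h"
    using mono_extends[OF u] unfolding extends_to_endo_def by blast
  have "(\<lambda>x. F1 x \<otimes> inv (F2 x)) \<in> hom G G" using endo_prod[OF F1(1) endo_inv[OF F2(1)]] .
  moreover have "F1 h \<otimes> inv (F2 h) = f h" if h: "h \<in> H" for h
  proof -
    have "u h \<in> carrier G" "f h \<in> carrier G" using h uh f hom_from_closed by auto
    then show ?thesis using F1(2)[OF h] F2(2)[OF h] by (simp add: m_comm[of "u h" "f h"] m_assoc)
  qed
  ultimately show ?thesis by (intro bexI[of _ "\<lambda>x. F1 x \<otimes> inv (F2 x)"]) auto
qed

lemma perturbation_extends: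
  assumes f: "f \<in> hom_from H" and inj: "\<And>h. h \<in> H \<Longrightarrow> h \<otimes> f h = \<one> \<Longrightarrow> h = \<one>"
  shows "\<exists>F\<in>hom G G. \<forall>h\<in>H. F h = f h"
proof -
  have "(\<lambda>h. h) \<in> hom_from H" using subgroup.mem_carrier[OF H] by (intro hom_fromI) auto
  then have "(\<lambda>h. h) \<in> mon (G\<lparr>carrier := H\<rparr>) G" using hom_from_injI[OF _ H] by blast
  then show ?thesis using difference_extends[OF _ f inj] by blast
qed

text \<open>The group \<open>H\<close> is the internal direct product of \<open>B\<close> and the cyclic group generated by \<open>c\<close>.\<close>

definition splits :: "'a set \<Rightarrow> 'a \<Rightarrow> bool" where
  "splits B c \<longleftrightarrow> subgroup B G \<and> c \<in> carrier G \<and> H = adjoin B c \<and> (\<forall>k::int. c [^] k \<in> B \<longrightarrow> c [^] k = \<one>)"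

definition realizable :: "'a set \<Rightarrow> 'a \<Rightarrow> 'a \<Rightarrow> bool" where
  "realizable B c g \<longleftrightarrow> (\<exists>F\<in>hom G G. F c = g \<and> (\<forall>b\<in>B. F b = \<one>))"

lemma realizableI:
  "F \<in> hom G G \<Longrightarrow> F c = g \<Longrightarrow> (\<And>b. b \<in> B \<Longrightarrow> F b = \<one>) \<Longrightarrow> realizable B c g"
  unfolding realizable_def by (intro bexI[of _ F]) auto

lemma realizable_mult: "realizable B c g \<Longrightarrow> realizable B c g' \<Longrightarrow> realizable B c (g \<otimes> g')"
proof -
  assume "realizable B c g" "realizable B c g'"
  then obtain F F' where "F \<in> hom G G" "F c = g" "\<forall>b\<in>B. F b = \<one>"
    and "F' \<in> hom G G" "F' c = g'" "\<forall>b\<in>B. F' b = \<one>"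
    unfolding realizable_def by blast
  then show ?thesis
    unfolding realizable_def by (intro bexI[of _ "\<lambda>x. F x \<otimes> F' x"] endo_prod) auto
qed

lemma splitsD:
  assumes "splits B c"
  shows "subgroup B G" "c \<in> carrier G" "H = adjoin B c" "\<And>k::int. c [^] k \<in> B \<Longrightarrow> c [^] k = \<one>"
    "B \<subseteq> H" "c \<in> H"
  using assms adjoin_incl unfolding splits_def by auto

lemma split_hom:
  assumes sp: "splits B c" and \<beta>: "\<beta> \<in> hom_from B" and g: "g \<in> carrier G"
    and ord: "\<And>k::int. c [^] k = \<one> \<Longrightarrow> g [^] k = \<one>"
  obtains \<tau> where "\<tau> \<in> hom_from H" "\<And>b k. b \<in> B \<Longrightarrow> \<tau> (b \<otimes> c [^] (k::int)) = \<beta> b \<otimes> g [^] k"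
    "\<And>b. b \<in> B \<Longrightarrow> \<tau> b = \<beta> b" "\<tau> c = g"
proof -
  note s = splitsD[OF sp]
  have compat: "\<beta> (c [^] k) = g [^] k" if "c [^] k \<in> B" for k :: int
    using s(4)[OF that] ord hom_from_one[OF \<beta> s(1)] by simp
  show thesis
    by (rule hom_extend_one[OF s(1) \<beta> s(2) g compat]) (assumption, rule that[unfolded s(3)])
qed

text \<open>Suppose \<open>b \<otimes> c [^] n\<close> is killed by the perturbed inclusion. Then \<open>(c \<otimes> g) [^] n\<close> lies in \<open>B\<close>. Modulo
  \<open>B\<close>, the element \<open>c \<otimes> g\<close> has the full order \<open>p ^ Suc e\<close> by the last hypothesis, so this order
  divides \<open>n\<close> and the kernel is trivial.\<close>

lemma realizable_perturbation:
  fixes p :: int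
  assumes sp: "splits B c" and p: "prime p"
    and c: "c [^] (p ^ Suc e) = \<one>" "c [^] (p ^ e) \<noteq> \<one>"
    and g: "g \<in> carrier G" "g [^] (p ^ Suc e) = \<one>" and good: "c [^] (p ^ e) \<otimes> g [^] (p ^ e) \<notin> B"
  shows "realizable B c g"
proof -
  note s = splitsD[OF sp]
  interpret B: subgroup B G by (rule s(1))
  have gpow: "g [^] k = \<one>" if "c [^] k = \<one>" for k :: int
  proof -
    have "p ^ Suc e dvd k" using prime_power_order_dvd[OF triv_subgroup s(2) p, of e k] c that by simp
    then show ?thesis by (rule pow_dvd_one[OF g])
  qed
  obtain \<tau> where \<tau>: "\<tau> \<in> hom_from H" "\<And>b k. b \<in> B \<Longrightarrow> \<tau> (b \<otimes> c [^] (k::int)) = \<one> \<otimes> g [^] k"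
    "\<And>b. b \<in> B \<Longrightarrow> \<tau> b = \<one>" "\<tau> c = g"
    by (rule split_hom[OF sp trivial_hom g(1)]) (rule gpow, assumption, rule that)
  have inj: "h = \<one>" if h: "h \<in> H" "h \<otimes> \<tau> h = \<one>" for h
  proof -
    obtain b n where b: "b \<in> B" "h = b \<otimes> c [^] (n::int)" using h(1) s(3) by (auto simp: adjoin_def)
    have "b \<otimes> (c \<otimes> g) [^] n = \<one>"
      using h(2) b s(2) g(1) \<tau>(2)[OF b(1)] by (simp add: int_pow_distrib m_assoc)
    then have "(c \<otimes> g) [^] n = inv b"
      using b(1) s(2) g(1) by (intro eq_inv_of_mult_one) auto
    then have mem: "(c \<otimes> g) [^] n \<in> B" using b(1) by simp
    have "p ^ Suc e dvd n"
    proof (rule prime_power_order_dvd[OF s(1) _ p _ _ mem])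
      show "c \<otimes> g \<in> carrier G" using s(2) g(1) by simp
      show "(c \<otimes> g) [^] p ^ Suc e \<in> B" using c(1) g s(2) by (simp add: int_pow_distrib)
      show "(c \<otimes> g) [^] p ^ e \<notin> B" using good g(1) s(2) by (simp add: int_pow_distrib)
    qed
    then have "c [^] n = \<one>" using pow_dvd_one[OF s(2) c(1)] by simp
    moreover from this have "g [^] n = \<one>" by (rule gpow)
    ultimately show ?thesis using b h(2) \<tau>(2)[OF b(1), of n] by simp
  qed
  obtain F where F: "F \<in> hom G G" "\<forall>h\<in>H. F h = \<tau> h"
    using perturbation_extends[OF \<tau>(1) inj] by blast
  then have "F c = g" "\<forall>b\<in>B. F b = \<one>" using \<tau>(3,4) s(5,6) by auto
  then show ?thesis unfolding realizable_def using F(1) by blast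
qed

text \<open>A kernel element \<open>b \<otimes> c [^] n\<close> of the perturbed inclusion on which \<open>\<chi> b\<close> is nontrivial has a power
  \<open>(\<chi> b) [^] q\<close> equal to the socle element \<open>c [^] (p ^ e)\<close>. This puts \<open>b [^] q\<close> into \<open>\<langle>c\<rangle>\<close>, hence makes
  it trivial, contradicting the nontriviality of \<open>(\<chi> b) [^] q\<close>.\<close>

lemma complement_character_extends:
  fixes p :: int
  assumes sp: "splits B c" and p: "prime p"
    and c: "c [^] (p ^ e) \<noteq> \<one>"
    and y: "y \<in> carrier G" "y [^] (p ^ Suc m) = \<one>" "y [^] (p ^ m) = c [^] (p ^ e)"
    and \<chi>: "\<chi> \<in> hom_from B" "\<chi> ` B \<subseteq> range (\<lambda>l::int. y [^] l)"
  obtains F where "F \<in> hom G G" "F c = \<one>" "\<And>b. b \<in> B \<Longrightarrow> F b = \<chi> b"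
proof -
  note s = splitsD[OF sp]
  interpret B: subgroup B G by (rule s(1))
  obtain \<tau> where \<tau>: "\<tau> \<in> hom_from H" "\<And>b k. b \<in> B \<Longrightarrow> \<tau> (b \<otimes> c [^] (k::int)) = \<chi> b \<otimes> \<one> [^] k"
    "\<And>b. b \<in> B \<Longrightarrow> \<tau> b = \<chi> b" "\<tau> c = \<one>"
    by (rule split_hom[OF sp \<chi>(1) one_closed]) (rule int_pow_one, rule that)
  have inj: "h = \<one>" if h: "h \<in> H" "h \<otimes> \<tau> h = \<one>" for h
  proof -
    obtain b n where b: "b \<in> B" "h = b \<otimes> c [^] (n::int)" using h(1) s(3) by (auto simp: adjoin_def)
    obtain l :: int where l: "\<chi> b = y [^] l" using \<chi>(2) b(1) by blast
    have lG: "\<chi> b \<in> carrier G" using y l by simp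
    have \<tau>h: "\<tau> h = \<chi> b" using \<tau>(2)[OF b(1)] b(2) lG by simp
    have "\<chi> b = \<one>"
    proof (rule ccontr)
      assume "\<chi> b \<noteq> \<one>"
      then obtain q :: int where q: "(\<chi> b) [^] q = c [^] (p ^ e)"
        using power_in_socle[OF y(1) p y(2)] y(3) l by metis
      have "(h \<otimes> \<chi> b) [^] q = \<one>" using h(2) \<tau>h by simp
      then have "b [^] q \<otimes> (c [^] (n * q) \<otimes> c [^] (p ^ e)) = \<one>"
        using b s(2) lG q by (simp add: int_pow_distrib int_pow_pow m_assoc)
      then have e1: "b [^] q \<otimes> c [^] (n * q + p ^ e) = \<one>" using s(2) by (simp add: int_pow_mult)
      then have "c [^] (n * q + p ^ e) = inv (b [^] q)"
        using b(1) s(2) by (intro eq_inv_of_mult_one) auto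
      then have "c [^] (n * q + p ^ e) \<in> B" using b(1) subgroup_int_pow_closed[OF s(1)] by simp
      then have "b [^] q = \<one>" using s(4) e1 b(1) by simp
      then have "(\<chi> b) [^] q = \<one>"
        using hom_from_pow[OF \<chi>(1) s(1) b(1), of q] hom_from_one[OF \<chi>(1) s(1)] by simp
      then show False using q c by simp
    qed
    then show ?thesis using h \<tau>h subgroup.mem_carrier[OF H] by simp
  qed
  obtain F where F: "F \<in> hom G G" "\<forall>h\<in>H. F h = \<tau> h"
    using perturbation_extends[OF \<tau>(1) inj] by blast
  then have "F c = \<one>" "F b = \<chi> b" if "b \<in> B" for b using that \<tau>(3,4) s(5,6) by auto
  then show thesis using that F(1) B.one_closed by blast
qed

text \<open>The root is a power of \<open>y\<close>, and the realizing endomorphism is a homomorphism \<open>G \<rightarrow> \<langle>y\<rangle>\<close> that is trivial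
  on \<open>B\<close> and on all \<open>p ^ Suc m\<close>-th powers. Such a homomorphism exists if the socle element
  \<open>c [^] (p ^ e)\<close> is not a product of an element of \<open>B\<close> and a \<open>p ^ Suc m\<close>-th power. The
  extension property of \<open>H\<close> excludes such a product.\<close>

lemma realizable_root_finite_height:
  fixes p :: int
  assumes sp: "splits B c" and p: "prime p"
    and c: "c [^] (p ^ Suc e) = \<one>" "c [^] (p ^ e) \<noteq> \<one>"
    and y: "y \<in> carrier G" "y [^] (p ^ m) = c [^] (p ^ e)" and em: "e \<le> m"
    and height: "\<And>x. x \<in> carrier G \<Longrightarrow> x [^] (p ^ Suc m) \<noteq> c [^] (p ^ e)"
  shows "\<exists>z\<in>carrier G. z [^] (p ^ e) = c [^] (p ^ e) \<and> realizable B c z"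
proof -
  note s = splitsD[OF sp]
  interpret B: subgroup B G by (rule s(1))
  have "y [^] (p ^ Suc m) = (y [^] (p ^ m)) [^] p" using y(1) by (simp add: int_pow_pow mult.commute)
  also have "\<dots> = c [^] (p ^ Suc e)" using s(2) by (simp add: y int_pow_pow mult.commute)
  finally have y1: "y [^] (p ^ Suc m) = \<one>" using c by simp
  have y2: "y [^] (p ^ m) \<noteq> \<one>" using y(2) c(2) by simp
  let ?PB = "(\<lambda>x. x [^] (p ^ Suc m)) ` B"
  let ?PG = "(\<lambda>x. x [^] (p ^ Suc m)) ` carrier G"
  have PB: "subgroup ?PB G" using pow_image_subgroup[OF s(1)] .
  have N: "subgroup (B <#> ?PG) G"
    using mult_subgroups[OF s(1) pow_image_subgroup[OF subgroup_self]] .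
  have c_out: "c [^] (p ^ e) \<notin> B <#> ?PG"
  proof
    assume "c [^] (p ^ e) \<in> B <#> ?PG"
    then obtain h x where h: "h \<in> B" and x: "x \<in> carrier G" and eq: "c [^] (p ^ e) = h \<otimes> x [^] (p ^ Suc m)"
      by (auto simp: set_mult_def)
    have "h \<notin> ?PB"
    proof
      assume "h \<in> ?PB"
      then obtain b where "b \<in> B" "h = b [^] (p ^ Suc m)" by blast
      then have "(b \<otimes> x) [^] (p ^ Suc m) = c [^] (p ^ e)" using x eq by (simp add: int_pow_distrib)
      then show False using height[of "b \<otimes> x"] \<open>b \<in> B\<close> x by simp
    qed
    \<comment> \<open>Take a homomorphism from \<open>B\<close> to \<open>\<langle>y\<rangle>\<close> that detects \<open>h\<close> modulo \<open>p ^ Suc m\<close>-th powers of \<open>B\<close>.\<close>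
    define a where "a = (LEAST a. h [^] (p ^ a) \<in> ?PB)"
    have "h [^] (p ^ Suc m) \<in> ?PB" using h by blast
    then have a: "h [^] (p ^ a) \<in> ?PB" "a \<le> Suc m"
      unfolding a_def by (rule LeastI, rule Least_le)
    have "a \<noteq> 0" using a(1) \<open>h \<notin> ?PB\<close> h by (metis B.mem_carrier int_pow_1 power_0)
    then obtain a' where a': "a = Suc a'" using not0_implies_Suc by blast
    have h_out: "h [^] (p ^ a') \<notin> ?PB" using not_less_Least[of a' "\<lambda>a. h [^] (p ^ a) \<in> ?PB"] a'
      unfolding a_def by simp
    have PB_sub: "?PB \<subseteq> B" using subgroup_int_pow_closed[OF s(1)] by blast
    have h_in: "h [^] (p ^ Suc a') \<in> ?PB" and am: "a' \<le> m" using a a' by simp_all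
    have pow_in: "x [^] (p ^ Suc m) \<in> ?PB" if "x \<in> B" for x using that by (rule imageI)
    obtain \<chi> where \<chi>: "\<chi> \<in> hom_from B" "\<chi> ` B \<subseteq> range (\<lambda>l::int. y [^] l)"
      "\<chi> h = y [^] (p ^ (m - a'))"
      by (rule cyclic_character[OF s(1) PB PB_sub p pow_in h h_in h_out am y(1) y1 y2])
        (assumption, rule that)
    have "(\<chi> h) [^] (p ^ a') = y [^] (p ^ m)"
      using a(2) a' y(1) by (simp add: \<chi>(3) int_pow_pow power_add[symmetric])
    then have \<chi>h: "\<chi> h \<noteq> \<one>" using y c by auto
    \<comment> \<open>Its extension kills \<open>c\<close>, so it maps the \<open>p ^ Suc m\<close>-th power of \<open>x\<close> to the inverse of \<open>\<chi> h\<close>. Some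
      power of that element is \<open>c [^] (p ^ e)\<close>, which contradicts the height assumption.\<close>
    obtain F where F: "F \<in> hom G G" "F c = \<one>" "\<And>b. b \<in> B \<Longrightarrow> F b = \<chi> b"
      using complement_character_extends[OF sp p c(2) y(1) y1 y(2) \<chi>(1,2)] by blast
    have FG: "F x \<in> carrier G" using F(1) x by (auto simp: hom_def)
    have "F (c [^] (p ^ e)) = \<one>" using endo_pow[OF F(1) s(2)] F(2) by simp
    then have "\<one> = F (h \<otimes> x [^] (p ^ Suc m))" by (simp only: eq)
    also have "\<dots> = \<chi> h \<otimes> F x [^] (p ^ Suc m)"
      using hom_mult[OF F(1)] h x endo_pow[OF F(1) x] F(3) by simp
    finally have "F x [^] (p ^ Suc m) = inv (y [^] (p ^ (m - a')))"
      using FG y(1) unfolding \<chi>(3) by (metis int_pow_closed inv_equality m_comm)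
    then have Fx: "F x [^] (p ^ Suc m) = y [^] (- (p ^ (m - a')))" using y(1) by (simp add: int_pow_neg)
    have "y [^] (- (p ^ (m - a'))) \<noteq> \<one>"
      using \<chi>h y(1) unfolding \<chi>(3) by (simp add: int_pow_neg)
    then obtain q :: int where "(F x [^] (p ^ Suc m)) [^] q = c [^] (p ^ e)"
      using power_in_socle[OF y(1) p y1] Fx y(2) by metis
    then have "(F x [^] q) [^] (p ^ Suc m) = c [^] (p ^ e)"
      using FG by (simp add: int_pow_pow mult.commute)
    then show False using height[of "F x [^] q"] FG by simp
  qed
  have pow_in: "x [^] (p ^ Suc m) \<in> B <#> ?PG" if "x \<in> carrier G" for x
  proof -
    have "\<one> \<otimes> x [^] (p ^ Suc m) \<in> B <#> ?PG"
      using that B.one_closed unfolding set_mult_def by blast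
    then show ?thesis using that by simp
  qed
  have BN: "b \<in> B <#> ?PG" if "b \<in> B" for b
  proof -
    have "\<one> \<in> ?PG" using int_pow_one one_closed by (metis imageI)
    then have "b \<otimes> \<one> \<in> B <#> ?PG" using that unfolding set_mult_def by blast
    then show ?thesis using that by simp
  qed
  have c_in: "c [^] (p ^ Suc e) \<in> B <#> ?PG" using c(1) subgroup.one_closed[OF N] by simp
  obtain \<psi> where \<psi>: "\<psi> \<in> hom_from (carrier G)" "\<And>a. a \<in> B <#> ?PG \<Longrightarrow> \<psi> a = \<one>"
    "\<psi> c = y [^] (p ^ (m - e))"
    by (rule cyclic_character[OF subgroup_self N subgroup.subset[OF N] p pow_in s(2) c_in c_out em y(1) y1 y2])
      (assumption, rule that)
  have "(y [^] (p ^ (m - e))) [^] (p ^ e) = c [^] (p ^ e)"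
    using y em by (simp add: int_pow_pow power_add[symmetric])
  moreover have "realizable B c (y [^] (p ^ (m - e)))"
    using \<psi> BN unfolding realizable_def by auto
  ultimately show ?thesis using y(1) by blast
qed

text \<open>Infinite height provides a root \<open>z\<close> of \<open>c [^] (p ^ e)\<close> inside a divisible \<open>p\<close>-group, and homomorphisms
  into divisible groups always extend.\<close>

lemma realizable_root_infinite_height:
  fixes p :: int
  assumes sp: "splits B c" and p: "prime p"
    and c: "c [^] (p ^ Suc e) = \<one>" "c [^] (p ^ e) \<noteq> \<one>"
    and height: "\<And>n. \<exists>x\<in>carrier G. x [^] (p ^ n) = c [^] (p ^ e)"
    and fin: "finite {t \<in> carrier G. t [^] p = \<one> \<and> (\<exists>x\<in>carrier G. t = x [^] (p ^ e))}"
  shows "\<exists>z\<in>carrier G. z [^] (p ^ e) = c [^] (p ^ e) \<and> realizable B c z"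
proof -
  note s = splitsD[OF sp]
  obtain D n\<^sub>0 where D: "subgroup D G" "\<And>v. v \<in> D \<Longrightarrow> \<exists>k::nat. v [^] (p ^ k) = \<one>"
    "\<And>v. v \<in> D \<Longrightarrow> \<exists>w\<in>D. w [^] p = v"
    "\<And>x k. x \<in> carrier G \<Longrightarrow> x [^] (p ^ k) = \<one> \<Longrightarrow> x [^] (p ^ n\<^sub>0) \<in> D"
    using divisible_part[OF p fin] by blast
  obtain v where v: "v \<in> carrier G" "v [^] (p ^ (n\<^sub>0 + e)) = c [^] (p ^ e)" using height by blast
  define z where "z = v [^] (p ^ n\<^sub>0)"
  have zG: "z \<in> carrier G" using v by (simp add: z_def)
  have ze: "z [^] (p ^ e) = c [^] (p ^ e)" using v by (simp add: z_def int_pow_pow power_add)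
  have "z [^] (p ^ Suc e) = (z [^] (p ^ e)) [^] p" using zG by (simp add: int_pow_pow mult.commute)
  also have "\<dots> = c [^] (p ^ Suc e)" using s(2) by (simp add: ze int_pow_pow mult.commute)
  finally have z1: "z [^] (p ^ Suc e) = \<one>" using c by simp
  then have "v [^] (p ^ (n\<^sub>0 + Suc e)) = \<one>" using v(1) by (simp add: z_def int_pow_pow power_add mult_ac)
  then have zD: "z \<in> D" unfolding z_def by (rule D(4)[OF v(1)])
  have zpow: "z [^] k = \<one>" if "c [^] k = \<one>" for k :: int
  proof -
    have "p ^ Suc e dvd k" using prime_power_order_dvd[OF triv_subgroup s(2) p, of e k] c that by simp
    then show ?thesis by (rule pow_dvd_one[OF zG z1])
  qed
  obtain \<tau> where \<tau>: "\<tau> \<in> hom_from H" "\<And>b k. b \<in> B \<Longrightarrow> \<tau> (b \<otimes> c [^] (k::int)) = \<one> \<otimes> z [^] k"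
    "\<And>b. b \<in> B \<Longrightarrow> \<tau> b = \<one>" "\<tau> c = z"
    by (rule split_hom[OF sp trivial_hom zG]) (rule zpow, assumption, rule that)
  have "\<tau> ` H \<subseteq> D"
    using \<tau>(2) subgroup_int_pow_closed[OF D(1) zD] zG by (auto simp: s(3) adjoin_def)
  obtain \<psi> where \<psi>: "\<psi> \<in> hom_from (carrier G)" "\<And>h. h \<in> H \<Longrightarrow> \<psi> h = \<tau> h"
  proof (rule extend_into_p_group[OF subgroup_self D(1) H subgroup.subset[OF H] \<tau>(1) \<open>\<tau> ` H \<subseteq> D\<close> p D(2)])
    fix L \<xi> x
    assume "\<xi> ` L \<subseteq> D" "x [^] p \<in> L"
    then show "\<exists>w\<in>D. w [^] p = \<xi> (x [^] p)" using D(3) by blast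
  qed (assumption, rule that)
  have "realizable B c z"
    by (rule realizableI[of \<psi>]) (use \<psi> \<tau>(3,4) s(5,6) in \<open>auto simp: subset_iff\<close>)
  then show ?thesis using zG ze by blast
qed

text \<open>Realizable elements are closed under products, so it is enough to factor \<open>c\<close> into two realizable
  elements. If elements of order dividing \<open>p ^ Suc e\<close> can have their \<open>p ^ e\<close>-th power outside \<open>H\<close>, two
  perturbations of the inclusion suffice. If not, the elements of order \<open>p\<close> and height at least \<open>e\<close>
  form a finite set, and one factor is a realizable root of \<open>c [^] (p ^ e)\<close>.\<close>

lemma realizable_generator_prime_power:
  fixes p :: int
  assumes sp: "splits B c" and p: "prime p"
    and c: "c [^] (p ^ Suc e) = \<one>" "c [^] (p ^ e) \<noteq> \<one>"
    and fin: "finite {h \<in> H. h [^] p = \<one>}"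
  shows "realizable B c c"
proof -
  note s = splitsD[OF sp]
  interpret B: subgroup B G by (rule s(1))
  interpret H: subgroup H G by (rule H)
  let ?s = "c [^] (p ^ e)"
  have sH: "?s \<in> H" using s(6) subgroup_int_pow_closed[OF H] by simp
  have sB: "?s \<notin> B" using s(4) c(2) by blast
  have powS: "x [^] (p ^ Suc e) = (x [^] (p ^ e)) [^] p" if "x \<in> carrier G" for x
    using that by (simp add: int_pow_pow mult.commute)
  show ?thesis
  proof (cases "\<exists>g\<in>carrier G. g [^] (p ^ Suc e) = \<one> \<and> g [^] (p ^ e) \<notin> H")
    case True
    then obtain g where g: "g \<in> carrier G" "g [^] (p ^ Suc e) = \<one>" "g [^] (p ^ e) \<notin> H" by blast
    define t where "t = g [^] (p ^ e)"
    have t: "t \<in> carrier G" "t \<notin> H" using g by (simp_all add: t_def)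
    have "?s \<otimes> t \<notin> B"
    proof
      assume "?s \<otimes> t \<in> B"
      then have "inv ?s \<otimes> (?s \<otimes> t) \<in> H" using s(5) sH by blast
      then show False using t sH by (simp add: m_assoc[symmetric])
    qed
    then have "realizable B c g" using realizable_perturbation[OF sp p c g(1,2)] by (simp add: t_def)
    moreover have "realizable B c (c \<otimes> inv g)"
    proof (rule realizable_perturbation[OF sp p c])
      show "(c \<otimes> inv g) [^] (p ^ Suc e) = \<one>"
        using s(2) g c by (simp add: int_pow_distrib int_pow_inv del: power_Suc)
      have pw: "(c \<otimes> inv g) [^] (p ^ e) = ?s \<otimes> inv t"
        using s(2) g by (simp add: int_pow_distrib int_pow_inv t_def)
      show "?s \<otimes> (c \<otimes> inv g) [^] (p ^ e) \<notin> B"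
      proof
        assume "?s \<otimes> (c \<otimes> inv g) [^] (p ^ e) \<in> B"
        then have "inv (?s \<otimes> (?s \<otimes> inv t)) \<otimes> (?s \<otimes> ?s) \<in> H" using s(5) sH pw by auto
        moreover have "inv (?s \<otimes> (?s \<otimes> inv t)) \<otimes> (?s \<otimes> ?s) = t"
        proof -
          have "?s \<otimes> (?s \<otimes> inv t) \<otimes> t = ?s \<otimes> ?s" using t s(2) by (simp add: m_assoc)
          then show ?thesis using t s(2) by (simp add: inv_solve_left')
        qed
        ultimately show False using t by simp
      qed
    qed (use s(2) g in simp)
    ultimately have "realizable B c (g \<otimes> (c \<otimes> inv g))" by (rule realizable_mult)
    moreover have "g \<otimes> (c \<otimes> inv g) = c" using s(2) g(1) by (simp add: m_lcomm[of g c])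
    ultimately show ?thesis by simp
  next
    case False
    have "\<exists>z\<in>carrier G. z [^] (p ^ e) = ?s \<and> realizable B c z"
    proof (cases "\<forall>n. \<exists>x\<in>carrier G. x [^] (p ^ n) = ?s")
      case True
      have "{t \<in> carrier G. t [^] p = \<one> \<and> (\<exists>x\<in>carrier G. t = x [^] (p ^ e))} \<subseteq> {h \<in> H. h [^] p = \<one>}"
        using False powS by auto
      then show ?thesis
        using realizable_root_infinite_height[OF sp p c] True finite_subset[OF _ fin] by blast
    next
      case no: False
      then obtain n where n: "\<not> (\<exists>x\<in>carrier G. x [^] (p ^ n) = ?s)"
        and least: "\<forall>m<n. \<not> \<not> (\<exists>x\<in>carrier G. x [^] (p ^ m) = ?s)"
        using exists_least_iff[of "\<lambda>n. \<not> (\<exists>x\<in>carrier G. x [^] (p ^ n) = ?s)"] by auto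
      have "e < n"
      proof (rule ccontr)
        assume "\<not> e < n"
        then have "(c [^] (p ^ (e - n))) [^] (p ^ n) = ?s"
          using s(2) by (simp add: int_pow_pow power_add[symmetric])
        moreover have "c [^] (p ^ (e - n)) \<in> carrier G" using s(2) by simp
        ultimately show False using n by blast
      qed
      then obtain m where m: "n = Suc m" "e \<le> m" by (metis less_Suc_eq_le less_imp_Suc_add)
      then obtain y where y: "y \<in> carrier G" "y [^] (p ^ m) = ?s" using least by auto
      have "x [^] (p ^ Suc m) \<noteq> ?s" if "x \<in> carrier G" for x using n m(1) that by auto
      then show ?thesis by (rule realizable_root_finite_height[OF sp p c y m(2)])
    qed
    then obtain z where z: "z \<in> carrier G" "z [^] (p ^ e) = ?s" "realizable B c z" by blast
    have w: "(c \<otimes> inv z) [^] (p ^ e) = \<one>"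
      using s(2) z by (simp add: int_pow_distrib int_pow_inv)
    have "realizable B c (c \<otimes> inv z)"
    proof (rule realizable_perturbation[OF sp p c])
      show "(c \<otimes> inv z) [^] (p ^ Suc e) = \<one>" using powS[of "c \<otimes> inv z"] w s(2) z(1) by simp
      show "?s \<otimes> (c \<otimes> inv z) [^] (p ^ e) \<notin> B" using w sB s(2) by simp
    qed (use s(2) z(1) in simp)
    then have "realizable B c (z \<otimes> (c \<otimes> inv z))" using z(3) realizable_mult by blast
    moreover have "z \<otimes> (c \<otimes> inv z) = c" using s(2) z(1) by (simp add: m_lcomm[of z c])
    ultimately show ?thesis by simp
  qed
qed

text \<open>When the perturbation by \<open>g\<close> fails to be injective, the one by \<open>g \<otimes> inv c\<close> is injective, since
  otherwise both \<open>c [^] (p ^ e) \<otimes> g [^] (p ^ e)\<close> and \<open>g [^] (p ^ e)\<close> would lie in \<open>B\<close>, and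
  with them \<open>c [^] (p ^ e)\<close>.\<close>

lemma realizable_prime_power:
  fixes p :: int
  assumes sp: "splits B c" and p: "prime p"
    and c: "c [^] (p ^ Suc e) = \<one>" "c [^] (p ^ e) \<noteq> \<one>"
    and fin: "finite {h \<in> H. h [^] p = \<one>}" and g: "g \<in> carrier G" "g [^] (p ^ Suc e) = \<one>"
  shows "realizable B c g"
proof (cases "c [^] (p ^ e) \<otimes> g [^] (p ^ e) \<in> B")
  case False
  then show ?thesis using realizable_perturbation[OF sp p c g] by simp
next
  case True
  note s = splitsD[OF sp]
  interpret B: subgroup B G by (rule s(1))
  have gB: "g [^] (p ^ e) \<notin> B"
  proof
    assume "g [^] (p ^ e) \<in> B"
    then have "(c [^] (p ^ e) \<otimes> g [^] (p ^ e)) \<otimes> inv (g [^] (p ^ e)) \<in> B" using True by simp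
    then have "c [^] (p ^ e) \<in> B" using s(2) g(1) by (simp add: m_assoc)
    then show False using s(4) c(2) by blast
  qed
  have "realizable B c (g \<otimes> inv c)"
  proof (rule realizable_perturbation[OF sp p c])
    show "(g \<otimes> inv c) [^] (p ^ Suc e) = \<one>"
      using s(2) g c by (simp add: int_pow_distrib int_pow_inv del: power_Suc)
    have "c [^] (p ^ e) \<otimes> (g \<otimes> inv c) [^] (p ^ e) = g [^] (p ^ e) \<otimes> (c [^] (p ^ e) \<otimes> inv (c [^] (p ^ e)))"
      using s(2) g(1) by (simp add: int_pow_distrib int_pow_inv m_lcomm[of "c [^] (p ^ e)" "g [^] (p ^ e)"])
    then show "c [^] (p ^ e) \<otimes> (g \<otimes> inv c) [^] (p ^ e) \<notin> B" using gB s(2) g(1) by simp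
  qed (use s(2) g in simp)
  then have "realizable B c (g \<otimes> inv c \<otimes> c)"
    using realizable_generator_prime_power[OF sp p c fin] realizable_mult by blast
  moreover have "g \<otimes> inv c \<otimes> c = g" using s(2) g(1) by (simp add: m_assoc)
  ultimately show ?thesis by simp
qed

text \<open>The Chinese remainder decomposition of \<open>\<langle>c\<rangle>\<close> into the subgroups of order \<open>b\<close> and \<open>a\<close> generated by
  \<open>c [^] a\<close> and \<open>c [^] b\<close>; the second one is moved into the complement.\<close>

lemma splits_coprime:
  fixes a b :: int
  assumes sp: "splits B c" and ord: "\<And>k. c [^] k = \<one> \<Longrightarrow> a * b dvd k" and ab: "c [^] (a * b) = \<one>"
    and cop: "coprime a b"
  shows "splits (adjoin B (c [^] b)) (c [^] a)"
proof -
  note s = splitsD[OF sp]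
  interpret B: subgroup B G by (rule s(1))
  have sub: "subgroup (adjoin B (c [^] b)) G" using adjoin_subgroup[OF s(1)] s(2) by simp
  interpret S: subgroup "adjoin (adjoin B (c [^] b)) (c [^] a)" G
    using adjoin_subgroup[OF sub] s(2) by simp
  let ?B = "adjoin B (c [^] b)"
  have H_eq: "H = adjoin ?B (c [^] a)"
  proof
    have "c [^] k \<in> H" for k :: int using subgroup_int_pow_closed[OF H s(6)] .
    then show "adjoin ?B (c [^] a) \<subseteq> H"
      using adjoin_subset[OF H _ ] s(5) by metis
    have in1: "?B \<subseteq> adjoin ?B (c [^] a)" "c [^] a \<in> adjoin ?B (c [^] a)"
      using adjoin_incl[OF sub] s(2) by auto
    have in2: "B \<subseteq> ?B" "c [^] b \<in> ?B" using adjoin_incl[OF s(1)] s(2) by auto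
    have "c [^] gcd a b \<in> adjoin ?B (c [^] a)"
      using gcd_pow_mem[OF S.subgroup_axioms s(2)] in1 in2 by blast
    then have "c \<in> adjoin ?B (c [^] a)" using cop s(2) by simp
    then show "H \<subseteq> adjoin ?B (c [^] a)"
      using adjoin_subset[OF S.subgroup_axioms, of B c] in1 in2 s(3) by blast
  qed
  have "(c [^] a) [^] k = \<one>" if mem: "(c [^] a) [^] k \<in> ?B" for k :: int
  proof -
    obtain b' l where b': "b' \<in> B" "(c [^] a) [^] k = b' \<otimes> (c [^] b) [^] (l::int)"
      using mem by (auto simp: adjoin_def)
    then have "c [^] (a * k - b * l) = b' \<otimes> c [^] (b * l) \<otimes> inv (c [^] (b * l))"
      using s(2) by (simp add: int_pow_pow int_pow_diff)
    also have "\<dots> = b'" using b'(1) s(2) by (simp add: m_assoc)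
    finally have "c [^] (a * k - b * l) = \<one>" using s(4)[of "a * k - b * l"] b'(1) by simp
    then have "b dvd a * k - b * l" using ord by (meson dvd_mult_right)
    then have "b dvd (a * k - b * l) + b * l" by (rule dvd_add) simp
    then have "b dvd a * k" by simp
    then have "b dvd k" using cop by (simp add: coprime_commute coprime_dvd_mult_right_iff)
    then show ?thesis using pow_dvd_one[OF s(2) ab, of "a * k"] s(2) by (simp add: int_pow_pow)
  qed
  then show ?thesis unfolding splits_def using sub s(2) H_eq by simp
qed

text \<open>The primary case is reached by splitting off coprime parts of the order. The two endomorphisms
  obtained for the parts are multiplied, each being trivial on the part of the other.\<close>

lemma realizable_finite_order:
  assumes fin: "\<And>p::int. prime p \<Longrightarrow> finite {h \<in> H. h [^] p = \<one>}"
    and "splits B c" "0 < N" "c [^] int N = \<one>" "\<And>k. c [^] k = \<one> \<Longrightarrow> int N dvd k"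
    and "g \<in> carrier G" "g [^] int N = \<one>"
  shows "realizable B c g"
  using assms(2-)
proof (induction N arbitrary: B c g rule: less_induct)
  case (less N)
  note sp = less.prems(1) and s = splitsD[OF less.prems(1)]
  note ord = less.prems(4) and g = less.prems(5,6)
  show ?case
  proof (cases "N = 1")
    case True
    then have "c = \<one>" "g = \<one>" using less.prems s(2) by auto
    then show ?thesis by (intro realizableI[of "\<lambda>_. \<one>"]) (auto simp: hom_def)
  next
    case False
    then obtain q where q: "prime q" "q dvd N" using prime_factor_nat by blast
    obtain r where r: "N = q ^ multiplicity q N * r" "\<not> q dvd r"
      using multiplicity_decompose'[of N q] q less.prems(2) by (metis not_prime_unit less_numeral_extra(3))
    define a where "a = q ^ multiplicity q N"
    have mult: "multiplicity q N \<noteq> 0" using r q by (metis mult_1 power_0)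
    have N: "N = a * r" using r by (simp add: a_def)
    have "coprime a r" using q r(2) by (simp add: a_def prime_imp_coprime)
    then have cop: "coprime (int a) (int r)" by simp
    have "1 < a" unfolding a_def using one_less_power[OF prime_gt_1_nat[OF q(1)]] mult by simp
    show ?thesis
    proof (cases "r = 1")
      case True
      obtain e where e: "multiplicity q N = Suc e" using mult not0_implies_Suc by blast
      have Ne: "int N = int q ^ Suc e" using True N e by (simp add: a_def)
      have qp: "prime (int q)" using q by simp
      have "c [^] (int q ^ e) \<noteq> \<one>"
      proof
        assume "c [^] (int q ^ e) = \<one>"
        then have "int q ^ Suc e dvd int q ^ e" using ord Ne by simp
        then show False using prime_gt_1_int[OF qp] by (simp add: power_dvd_imp_le dvd_power_iff)
      qed
      then show ?thesis
        using realizable_prime_power[OF sp qp _ _ fin[OF qp] g(1)] less.prems(3) g(2) Ne by simp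
    next
      case False
      have "0 < r" using N less.prems(2) by (auto intro: Nat.gr0I)
      then have lt: "r < N" "a < N" using N False \<open>1 < a\<close> by auto
      have ord': "int a * int r dvd k" "int r * int a dvd k" if "c [^] k = \<one>" for k
        using ord[OF that] N by (simp_all add: mult.commute)
      have one: "c [^] (int a * int r) = \<one>" "c [^] (int r * int a) = \<one>"
        using less.prems(3) N by (simp_all add: mult.commute)
      have gone: "g [^] (int a * int r) = \<one>" "g [^] (int r * int a) = \<one>"
        using g N by (simp_all add: mult.commute)
      let ?B1 = "adjoin B (c [^] int r)" and ?B2 = "adjoin B (c [^] int a)"
      have "realizable ?B1 (c [^] int a) (g [^] int a)"
      proof (rule less.IH[OF lt(1) splits_coprime[OF sp ord'(1) one(1) cop] \<open>0 < r\<close>])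
        show "int r dvd k" if "(c [^] int a) [^] k = \<one>" for k
          using ord'(1)[of "int a * k"] that s(2) \<open>1 < a\<close> by (simp add: int_pow_pow)
      qed (use s(2) g one gone in \<open>simp_all add: int_pow_pow\<close>)
      then obtain F1 where F1: "F1 \<in> hom G G" "F1 (c [^] int a) = g [^] int a" "\<And>b. b \<in> ?B1 \<Longrightarrow> F1 b = \<one>"
        unfolding realizable_def by blast
      have "realizable ?B2 (c [^] int r) (g [^] int r)"
      proof (rule less.IH[OF lt(2) splits_coprime[OF sp ord'(2) one(2)]])
        show "coprime (int r) (int a)" using cop by (simp add: coprime_commute)
        show "int a dvd k" if "(c [^] int r) [^] k = \<one>" for k
          using ord'(2)[of "int r * k"] that s(2) \<open>0 < r\<close> by (simp add: int_pow_pow)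
      qed (use s(2) g one gone \<open>1 < a\<close> in \<open>simp_all add: int_pow_pow\<close>)
      then obtain F2 where F2: "F2 \<in> hom G G" "F2 (c [^] int r) = g [^] int r" "\<And>b. b \<in> ?B2 \<Longrightarrow> F2 b = \<one>"
        unfolding realizable_def by blast
      let ?F = "\<lambda>x. F1 x \<otimes> F2 x"
      have F: "?F \<in> hom G G" using endo_prod[OF F1(1) F2(1)] .
      have "c [^] int r \<in> ?B1" "c [^] int a \<in> ?B2" and BB: "B \<subseteq> ?B1" "B \<subseteq> ?B2"
        using adjoin_incl[OF s(1)] s(2) by auto
      then have Fa: "?F (c [^] int a) = g [^] int a" and Fr: "?F (c [^] int r) = g [^] int r"
        using F1 F2 g(1) by simp_all
      obtain u v where uv: "u * int a + v * int r = 1" using bezout_int[of "int a" "int r"] cop by auto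
      have split: "x = (x [^] int a) [^] u \<otimes> (x [^] int r) [^] v" if x: "x \<in> carrier G" for x
      proof -
        have "x = x [^] (u * int a + v * int r)" using x uv by simp
        then show ?thesis using x by (simp add: int_pow_mult int_pow_pow mult.commute)
      qed
      have "?F c = ?F ((c [^] int a) [^] u \<otimes> (c [^] int r) [^] v)" using split[OF s(2)] by simp
      also have "\<dots> = ?F ((c [^] int a) [^] u) \<otimes> ?F ((c [^] int r) [^] v)"
        using hom_mult[OF F] s(2) by simp
      also have "\<dots> = ?F (c [^] int a) [^] u \<otimes> ?F (c [^] int r) [^] v"
        using endo_pow[OF F] s(2) by simp
      also have "\<dots> = g" unfolding Fa Fr using split[OF g(1)] by simp
      finally have "?F c = g" .
      moreover have "?F b = \<one>" if "b \<in> B" for b using that BB F1(3) F2(3) by (simp add: subset_iff)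
      ultimately show ?thesis using F by (intro realizableI[of ?F])
    qed
  qed
qed

text \<open>If the perturbation \<open>c \<mapsto> c \<otimes> g\<close> has a kernel, then a nonzero power of \<open>g\<close> agrees with the same power of
  \<open>inv c\<close> up to elements of \<open>B\<close>. Perturbing the monomorphism \<open>c \<mapsto> c [^] 2\<close> instead would require the same
  with \<open>inv c [^] 2\<close>; both cannot happen, as no nonzero power of \<open>c\<close> lies in \<open>B\<close>.\<close>

lemma realizable_infinite_order:
  assumes sp: "splits B c" and ord: "\<And>k::int. c [^] k = \<one> \<Longrightarrow> k = 0" and g: "g \<in> carrier G"
  shows "realizable B c g"
proof -
  note s = splitsD[OF sp]
  interpret B: subgroup B G by (rule s(1))
  have zero: "k = 0" if "c [^] k \<in> B" for k :: int using ord s(4) that by blast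
  have ord0: "x [^] k = \<one>" if "c [^] k = \<one>" for x and k :: int using ord[OF that] by simp
  obtain \<tau> where \<tau>: "\<tau> \<in> hom_from H" "\<And>b k. b \<in> B \<Longrightarrow> \<tau> (b \<otimes> c [^] (k::int)) = \<one> \<otimes> g [^] k"
    "\<And>b. b \<in> B \<Longrightarrow> \<tau> b = \<one>" "\<tau> c = g"
    by (rule split_hom[OF sp trivial_hom g]) (rule ord0, assumption, rule that)
  have "(\<lambda>h. h) \<in> hom_from B" by (intro hom_fromI) auto
  then obtain u where u: "u \<in> hom_from H"
    "\<And>b k. b \<in> B \<Longrightarrow> u (b \<otimes> c [^] (k::int)) = b \<otimes> (c [^] (2::int)) [^] k"
    by (rule split_hom[OF sp _ int_pow_closed[OF s(2)]]) (rule ord0, assumption, rule that)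
  have "\<exists>F\<in>hom G G. \<forall>h\<in>H. F h = \<tau> h"
  proof (cases "\<forall>h\<in>H. h \<otimes> \<tau> h = \<one> \<longrightarrow> h = \<one>")
    case True
    then show ?thesis using perturbation_extends[OF \<tau>(1)] by blast
  next
    case False
    then obtain h where h: "h \<in> H" "h \<otimes> \<tau> h = \<one>" "h \<noteq> \<one>" by blast
    then obtain b n where b: "b \<in> B" "h = b \<otimes> c [^] (n::int)" using s(3) by (auto simp: adjoin_def)
    have "n \<noteq> 0" using h b \<tau>(2)[OF b(1), of n] by auto
    have rel: "b \<otimes> c [^] n \<otimes> g [^] n = \<one>" using h(2) b \<tau>(2)[OF b(1), of n] g by simp
    have "u \<in> mon (G\<lparr>carrier := H\<rparr>) G"
    proof (rule hom_from_injI[OF u(1) H])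
      fix x assume x: "x \<in> H" "u x = \<one>"
      then obtain b' k where b': "b' \<in> B" "x = b' \<otimes> c [^] (k::int)" using s(3) by (auto simp: adjoin_def)
      then have rel': "b' \<otimes> c [^] (2 * k) = \<one>" using x(2) u(2) s(2) by (simp add: int_pow_pow)
      then have "c [^] (2 * k) = inv b'" using b'(1) s(2) by (intro eq_inv_of_mult_one) auto
      then have "c [^] (2 * k) \<in> B" using b'(1) by simp
      then have "k = 0" using zero by force
      then show "x = \<one>" using b' rel' by simp
    qed
    moreover have inj: "x = \<one>" if x: "x \<in> H" "u x \<otimes> \<tau> x = \<one>" for x
    proof -
      obtain b' k where b': "b' \<in> B" "x = b' \<otimes> c [^] (k::int)" using x(1) s(3) by (auto simp: adjoin_def)
      have rel': "b' \<otimes> c [^] (2 * k) \<otimes> g [^] k = \<one>"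
        using x(2) b' u(2)[OF b'(1), of k] \<tau>(2)[OF b'(1), of k] g s(2) by (simp add: int_pow_pow)
      \<comment> \<open>Eliminating \<open>g\<close> from the two kernel relations leaves a power of \<open>c\<close> in \<open>B\<close>.\<close>
      have carr: "b \<in> carrier G" "b' \<in> carrier G" using b b' by auto
      have "b [^] k \<otimes> c [^] (n * k) \<otimes> g [^] (n * k) = (b \<otimes> c [^] n \<otimes> g [^] n) [^] k"
        using carr s(2) g by (simp add: int_pow_distrib int_pow_pow)
      also have "\<dots> = \<one>" by (simp add: rel)
      finally have 1: "b [^] k \<otimes> c [^] (n * k) \<otimes> g [^] (n * k) = \<one>" .
      have "b' [^] n \<otimes> c [^] (2 * k * n) \<otimes> g [^] (k * n) = (b' \<otimes> c [^] (2 * k) \<otimes> g [^] k) [^] n"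
        using carr s(2) g by (simp add: int_pow_distrib int_pow_pow)
      also have "\<dots> = \<one>" by (simp add: rel')
      finally have 2: "b' [^] n \<otimes> c [^] (2 * k * n) \<otimes> g [^] (n * k) = \<one>" by (simp add: mult.commute)
      have 3: "b [^] k \<otimes> c [^] (n * k) = b' [^] n \<otimes> c [^] (2 * k * n)"
        using 1 2 carr s(2) g right_cancel[of "g [^] (n * k)" "b [^] k \<otimes> c [^] (n * k)" "b' [^] n \<otimes> c [^] (2 * k * n)"]
        by simp
      have "c [^] (2 * k * n) = c [^] (n * k) \<otimes> c [^] (n * k)"
        using s(2) by (simp add: int_pow_mult[symmetric] algebra_simps)
      then have "b [^] k \<otimes> c [^] (n * k) = (b' [^] n \<otimes> c [^] (n * k)) \<otimes> c [^] (n * k)"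
        using 3 carr s(2) by (simp add: m_assoc)
      then have "b [^] k = b' [^] n \<otimes> c [^] (n * k)"
        using carr s(2) right_cancel[of "c [^] (n * k)" "b [^] k" "b' [^] n \<otimes> c [^] (n * k)"]
        by simp
      then have "c [^] (n * k) = inv (b' [^] n) \<otimes> b [^] k" using carr s(2) by (simp add: inv_solve_left)
      then have "c [^] (n * k) \<in> B" using b(1) b'(1) subgroup_int_pow_closed[OF s(1)] by simp
      then have "k = 0" using zero \<open>n \<noteq> 0\<close> by fastforce
      then show ?thesis using rel' b' by simp
    qed
    ultimately show ?thesis using difference_extends[OF _ \<tau>(1)] by blast
  qed
  then obtain F where F: "F \<in> hom G G" "\<forall>h\<in>H. F h = \<tau> h" by blast
  then have "F c = g" "\<forall>b\<in>B. F b = \<one>" using \<tau>(3,4) s(5,6) by auto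
  then show ?thesis unfolding realizable_def using F(1) by blast
qed

lemma realizable_any:
  assumes sp: "splits B c" and fin: "\<And>p::int. prime p \<Longrightarrow> finite {h \<in> H. h [^] p = \<one>}"
    and g: "g \<in> carrier G" "\<And>k::int. c [^] k = \<one> \<Longrightarrow> g [^] k = \<one>"
  shows "realizable B c g"
proof -
  have ord: "c [^] k = \<one> \<longleftrightarrow> int (ord c) dvd k" for k :: int
    using int_pow_eq_id splitsD(2)[OF sp] by simp
  show ?thesis
  proof (cases "ord c = 0")
    case True
    then show ?thesis using realizable_infinite_order[OF sp _ g(1)] ord by simp
  next
    case False
    then show ?thesis using realizable_finite_order[OF fin sp, of "ord c" g] ord g by simp
  qed
qed

end


section \<open>Independent generators of finitely generated abelian groups\<close>

context comm_group
begin

lemma generate_insert: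
  assumes "x \<in> carrier G" "S \<subseteq> carrier G"
  shows "generate G (insert x S) = adjoin (generate G S) x"
proof
  have S: "subgroup (generate G S) G" and xS: "subgroup (generate G (insert x S)) G"
    using generate_is_subgroup assms by auto
  have "S \<subseteq> generate G S" by (auto intro: generate.incl)
  then have "insert x S \<subseteq> adjoin (generate G S) x" using adjoin_incl[OF S assms(1)] by blast
  then show "generate G (insert x S) \<subseteq> adjoin (generate G S) x"
    using generate_subgroup_incl[OF _ adjoin_subgroup[OF S assms(1)]] by blast
  have "generate G S \<subseteq> generate G (insert x S)" using mono_generate[of S "insert x S"] by blast
  moreover have "x \<in> generate G (insert x S)" by (auto intro: generate.incl)
  ultimately show "adjoin (generate G S) x \<subseteq> generate G (insert x S)"
    by (intro adjoin_subset[OF xS])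
qed

lemma finprod_in_subgroup:
  assumes "subgroup K G" "finite I" "\<And>i. i \<in> I \<Longrightarrow> f i \<in> K"
  shows "finprod G f I \<in> K"
  using assms(2,3)
proof (induction I)
  case empty
  then show ?case using subgroup.one_closed[OF assms(1)] by simp
next
  case (insert i I)
  then have "f \<in> insert i I \<rightarrow> carrier G" using subgroup.mem_carrier[OF assms(1)] by auto
  then show ?case using insert subgroup.m_closed[OF assms(1)] by simp
qed

lemma finprod_int_pow:
  assumes "finite I" "f \<in> I \<rightarrow> carrier G"
  shows "finprod G f I [^] (n::int) = (\<Otimes>i\<in>I. f i [^] n)"
  using assms
proof (induction I)
  case (insert i I)
  then have "finprod G f I \<in> carrier G" "(\<lambda>i. f i [^] n) \<in> I \<rightarrow> carrier G" by auto
  then show ?case using insert by (simp add: int_pow_distrib)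
qed simp

lemma finprod_remove:
  assumes "finite I" "i \<in> I" "f \<in> I \<rightarrow> carrier G"
  shows "finprod G f I = f i \<otimes> finprod G f (I - {i})"
proof -
  have "finprod G f (insert i (I - {i})) = f i \<otimes> finprod G f (I - {i})"
    using assms by (intro finprod_insert) auto
  then show ?thesis using assms(2) by (simp add: insert_absorb)
qed

lemma generate_family:
  assumes "finite I" "c \<in> I \<rightarrow> carrier G" "x \<in> generate G (c ` I)"
  shows "\<exists>k. x = (\<Otimes>i\<in>I. c i [^] (k i :: int))"
  using assms
proof (induction I arbitrary: x)
  case empty
  then show ?case using generate_empty by simp
next
  case (insert i I)
  have cI: "c ` I \<subseteq> carrier G" "c i \<in> carrier G" using insert.prems(1) by auto
  obtain a and n :: int where a: "a \<in> generate G (c ` I)" "x = a \<otimes> c i [^] n"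
    using insert.prems(2) generate_insert[OF cI(2,1)] by (auto simp: adjoin_def)
  obtain k where k: "a = (\<Otimes>i\<in>I. c i [^] (k i :: int))" using insert.IH[OF _ a(1)] cI by blast
  let ?k = "k(i := n)"
  have "(\<Otimes>j\<in>I. c j [^] ?k j) = a"
    unfolding k using insert.hyps cI by (intro finprod_cong') auto
  moreover have "(\<Otimes>j\<in>insert i I. c j [^] ?k j) = c i [^] n \<otimes> (\<Otimes>j\<in>I. c j [^] ?k j)"
    using insert.hyps cI by (subst finprod_insert) auto
  moreover have "a \<in> carrier G" using a(1) generate_in_carrier[OF cI(1)] by blast
  ultimately have "x = (\<Otimes>j\<in>insert i I. c j [^] ?k j)" using a(2) cI(2) by (simp add: m_comm)
  then show ?case by blast
qed

text \<open>The cyclic subgroups generated by the members form an internal direct product.\<close>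

definition independent_family :: "'i set \<Rightarrow> ('i \<Rightarrow> 'a) \<Rightarrow> bool" where
  "independent_family I c \<longleftrightarrow> (\<forall>i\<in>I. \<forall>k::int. c i [^] k \<in> generate G (c ` (I - {i})) \<longrightarrow> c i [^] k = \<one>)"

lemma generate_family_eqI:
  assumes "c \<in> I \<rightarrow> carrier G" "c' \<in> I \<rightarrow> carrier G"
    and "\<And>i. i \<in> I \<Longrightarrow> c' i \<in> generate G (c ` I)" "\<And>i. i \<in> I \<Longrightarrow> c i \<in> generate G (c' ` I)"
  shows "generate G (c' ` I) = generate G (c ` I)"
  using assms generate_subgroup_incl generate_is_subgroup
  by (intro equalityI generate_subgroup_incl generate_is_subgroup) auto

lemma relation_of_membership:
  assumes "finite I" "i \<in> I" "c \<in> I \<rightarrow> carrier G" and a: "c i [^] (a::int) \<in> generate G (c ` (I - {i}))"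
  obtains k where "(\<Otimes>j\<in>I. c j [^] (k j :: int)) = \<one>" "k i = a"
proof -
  have c: "c \<in> I - {i} \<rightarrow> carrier G" "c i \<in> carrier G" using assms by auto
  obtain l where l: "c i [^] a = (\<Otimes>j\<in>I - {i}. c j [^] (l j :: int))"
    using generate_family[OF _ c(1) a] assms(1) by blast
  define k where "k j = (if j = i then a else - l j)" for j
  have "(\<Otimes>j\<in>I - {i}. c j [^] k j) = (\<Otimes>j\<in>I - {i}. (c j [^] l j) [^] (-1::int))"
    using assms(3) by (intro finprod_cong') (auto simp: k_def int_pow_pow Pi_iff)
  also have "\<dots> = (c i [^] a) [^] (-1::int)"
    unfolding l using c assms(1) by (intro finprod_int_pow[symmetric]) auto
  finally have "(\<Otimes>j\<in>I - {i}. c j [^] k j) = inv (c i [^] a)" using c(2) by (simp add: int_pow_neg)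
  moreover have "(\<Otimes>j\<in>I. c j [^] k j) = c i [^] k i \<otimes> (\<Otimes>j\<in>I - {i}. c j [^] k j)"
    using assms by (intro finprod_remove) auto
  ultimately have "(\<Otimes>j\<in>I. c j [^] k j) = \<one>" using c(2) by (simp add: k_def)
  then show thesis by (rule that) (simp add: k_def)
qed

text \<open>Among all families that generate the given group and all relations between their members, take a
  positive coefficient \<open>m\<close> that is as small as possible; if there is none, the family has no relations. Division with remainder moves the multiples of
  \<open>m\<close> in the other coefficients into the generator that carries \<open>m\<close>; minimality leaves no remainders.
  The new generator is then killed by \<open>m\<close>, and by minimality again none of its powers other than the
  trivial one lies in the group generated by the others.\<close>

lemma split_off_generator:
  assumes I: "finite I" "I \<noteq> {}" and c: "c \<in> I \<rightarrow> carrier G"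
  obtains c' i where "i \<in> I" "c' \<in> I \<rightarrow> carrier G" "generate G (c' ` I) = generate G (c ` I)"
    "\<And>a::int. c' i [^] a \<in> generate G (c' ` (I - {i})) \<Longrightarrow> c' i [^] a = \<one>"
proof -
  define rel where "rel c' k \<longleftrightarrow> c' \<in> I \<rightarrow> carrier G \<and> generate G (c' ` I) = generate G (c ` I)
    \<and> (\<Otimes>j\<in>I. c' j [^] (k j :: int)) = \<one>" for c' k
  define coefficient where "coefficient m \<longleftrightarrow> (\<exists>c' k. \<exists>i\<in>I. rel c' k \<and> k i = int m \<and> 0 < m)" for m
  have coefficientI: "coefficient (nat a)"
    if d: "i \<in> I" "d \<in> I \<rightarrow> carrier G" "generate G (d ` I) = generate G (c ` I)"
      and a: "d i [^] a \<in> generate G (d ` (I - {i}))" "0 < a" for d i a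
  proof -
    obtain k where "(\<Otimes>j\<in>I. d j [^] (k j :: int)) = \<one>" "k i = a"
      using relation_of_membership[OF I(1) d(1,2) a(1)] .
    then show ?thesis using d a(2) unfolding coefficient_def rel_def by auto
  qed
  show thesis
  proof (cases "\<exists>m. coefficient m")
    case False
    obtain i where i: "i \<in> I" using I by blast
    have "c i [^] a = \<one>" if a: "c i [^] a \<in> generate G (c ` (I - {i}))" for a :: int
    proof -
      have sub: "subgroup (generate G (c ` (I - {i}))) G" using c by (intro generate_is_subgroup) auto
      have ci: "c i \<in> carrier G" using c i by blast
      have "c i [^] (- a) \<in> generate G (c ` (I - {i}))"
        using subgroup.m_inv_closed[OF sub a] ci by (simp add: int_pow_neg)
      then have "\<not> 0 < a" "\<not> 0 < - a" using coefficientI[OF i c refl] a False by blast+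
      then show ?thesis by simp
    qed
    then show thesis using that[OF i c refl] by blast
  next
    case True
    then obtain m where m: "coefficient m" and least: "\<And>n. n < m \<Longrightarrow> \<not> coefficient n"
      using exists_least_iff[of coefficient] by blast
    obtain d k i where i: "i \<in> I" and rel: "rel d k" and ki: "k i = int m" and m0: "0 < m"
      using m unfolding coefficient_def by blast
    have d: "d \<in> I \<rightarrow> carrier G" "generate G (d ` I) = generate G (c ` I)"
      and rel1: "(\<Otimes>j\<in>I. d j [^] k j) = \<one>" using rel by (auto simp: rel_def)
    have dG: "d j \<in> carrier G" if "j \<in> I" for j using d(1) that by blast
    \<comment> \<open>One Euclidean step on all coefficients of the relation at once.\<close>
    define e where "e = (\<Otimes>j\<in>I. d j [^] (k j div int m))"
    define d' where "d' = d(i := e)"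
    have eG: "e \<in> carrier G" using dG by (auto simp: e_def intro!: finprod_closed)
    have d': "d' \<in> I \<rightarrow> carrier G" using dG eG by (auto simp: d'_def)
    have d'_other: "d' j = d j" if "j \<noteq> i" for j using that by (simp add: d'_def)
    have subI: "subgroup (generate G (d ` I)) G" "subgroup (generate G (d' ` I)) G"
      using d(1) d' by (auto intro!: generate_is_subgroup)
    have gen: "generate G (d' ` I) = generate G (d ` I)"
    proof (rule generate_family_eqI[OF d(1) d'])
      have din: "d j \<in> generate G (d ` I)" if "j \<in> I" for j using that by (auto intro: generate.incl)
      have "e \<in> generate G (d ` I)" unfolding e_def
        using din by (intro finprod_in_subgroup[OF subI(1) I(1)] subgroup_int_pow_closed[OF subI(1)])
      then show "d' j \<in> generate G (d ` I)" if "j \<in> I" for j using din that by (simp add: d'_def)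
      have d'in: "d' j \<in> generate G (d' ` I)" if "j \<in> I" for j using that by (auto intro: generate.incl)
      let ?r = "\<Otimes>j\<in>I - {i}. d j [^] (k j div int m)"
      have "d j [^] (k j div int m) \<in> generate G (d' ` I)" if "j \<in> I - {i}" for j
        using d'in[of j] d'_other[of j] that subgroup_int_pow_closed[OF subI(2)] by simp
      then have r: "?r \<in> generate G (d' ` I)" using I(1) by (intro finprod_in_subgroup[OF subI(2)]) auto
      have rG: "?r \<in> carrier G" using r subgroup.mem_carrier[OF subI(2)] by blast
      have "e = d i [^] (k i div int m) \<otimes> ?r"
        unfolding e_def using I(1) i dG by (intro finprod_remove) auto
      then have "e = d i \<otimes> ?r" using ki m0 dG[OF i] by simp
      then have "d i = e \<otimes> inv ?r" using rG dG[OF i] by (simp add: m_assoc)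
      moreover have "e \<in> generate G (d' ` I)" using d'in[OF i] by (simp add: d'_def)
      ultimately have "d i \<in> generate G (d' ` I)"
        using r subgroup.m_closed[OF subI(2)] subgroup.m_inv_closed[OF subI(2)] by simp
      then show "d j \<in> generate G (d' ` I)" if "j \<in> I" for j
        using that d'in[of j] d'_other[of j] by (cases "j = i") simp_all
    qed
    define k' where "k' j = (if j = i then int m else k j mod int m)" for j
    have "(\<Otimes>j\<in>I. d' j [^] k' j) = d' i [^] k' i \<otimes> (\<Otimes>j\<in>I - {i}. d' j [^] k' j)"
      using I(1) i d' by (intro finprod_remove) auto
    also have "(\<Otimes>j\<in>I - {i}. d' j [^] k' j) = (\<Otimes>j\<in>I - {i}. d j [^] (k j mod int m))"
      using dG by (intro finprod_cong') (auto simp: d'_other k'_def)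
    also have "\<dots> = d i [^] (k i mod int m) \<otimes> (\<Otimes>j\<in>I - {i}. d j [^] (k j mod int m))"
      using ki dG by (auto intro!: finprod_closed)
    also have "\<dots> = (\<Otimes>j\<in>I. d j [^] (k j mod int m))"
      using I(1) i dG by (intro finprod_remove[symmetric]) auto
    also have "d' i [^] k' i = (\<Otimes>j\<in>I. (d j [^] (k j div int m)) [^] int m)"
      using finprod_int_pow[OF I(1), of "\<lambda>j. d j [^] (k j div int m)"] dG by (auto simp: d'_def k'_def e_def)
    also have "\<dots> \<otimes> (\<Otimes>j\<in>I. d j [^] (k j mod int m))
        = (\<Otimes>j\<in>I. (d j [^] (k j div int m)) [^] int m \<otimes> d j [^] (k j mod int m))"
      using dG by (intro finprod_multf[symmetric]) auto
    also have "\<dots> = (\<Otimes>j\<in>I. d j [^] k j)"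
      using dG by (intro finprod_cong') (auto simp: int_pow_pow int_pow_mult[symmetric])
    finally have rel': "(\<Otimes>j\<in>I. d' j [^] k' j) = \<one>" using rel1 by simp
    have no_coefficient: "\<not> (0 < n \<and> n < int m)" if "coefficient (nat n)" for n
      using least[of "nat n"] that nat_less_iff[of n m] by auto
    have "k' j = 0" if j: "j \<in> I" "j \<noteq> i" for j
    proof (rule ccontr)
      assume "k' j \<noteq> 0"
      moreover have "0 \<le> k' j" "k' j < int m" using j m0 by (simp_all add: k'_def)
      moreover have "coefficient (nat (k' j))"
        unfolding coefficient_def rel_def using j d' gen d(2) rel' \<open>k' j \<noteq> 0\<close> \<open>0 \<le> k' j\<close>
        by (intro exI[of _ d'] exI[of _ k'] bexI[of _ j]) auto
      ultimately show False using no_coefficient by fastforce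
    qed
    then have "(\<Otimes>j\<in>I - {i}. d' j [^] k' j) = \<one>" by (intro finprod_one_eqI) auto
    moreover have "(\<Otimes>j\<in>I. d' j [^] k' j) = d' i [^] k' i \<otimes> (\<Otimes>j\<in>I - {i}. d' j [^] k' j)"
      using I(1) i d' by (intro finprod_remove) auto
    ultimately have em: "e [^] int m = \<one>" using rel' eG by (simp add: d'_def k'_def)
    have "d' i [^] a = \<one>" if a: "d' i [^] a \<in> generate G (d' ` (I - {i}))" for a :: int
    proof -
      have "e [^] a = e [^] (int m * (a div int m)) \<otimes> e [^] (a mod int m)"
        using eG by (simp add: int_pow_mult[symmetric])
      then have ea: "e [^] a = e [^] (a mod int m)" using pow_dvd_one[OF eG em, of "int m * (a div int m)"] eG by simp
      have "\<not> 0 < a mod int m"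
      proof
        assume pos: "0 < a mod int m"
        have "coefficient (nat (a mod int m))"
          using coefficientI[OF i d' _ _ pos] gen d(2) a ea by (simp add: d'_def)
        then show False using no_coefficient pos m0 by (metis of_nat_0_less_iff pos_mod_bound)
      qed
      moreover have "0 \<le> a mod int m" using m0 by simp
      ultimately have "a mod int m = 0" by linarith
      then show ?thesis using ea by (simp add: d'_def)
    qed
    then show thesis using that[OF i d'] gen d(2) by simp
  qed
qed

text \<open>Splitting off one generator at a time keeps the earlier ones independent of the rest, because the
  remaining generators only change within the group they generate.\<close>

lemma independent_generators_exist:
  assumes "finite I" "c \<in> I \<rightarrow> carrier G"
  shows "\<exists>d\<in>I \<rightarrow> carrier G. generate G (d ` I) = generate G (c ` I) \<and> independent_family I d"
  using assms
proof (induction "card I" arbitrary: I c)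
  case 0
  then show ?case by (intro bexI[of _ c]) (auto simp: independent_family_def)
next
  case (Suc n)
  then have "I \<noteq> {}" by auto
  obtain c' i where i: "i \<in> I" and c': "c' \<in> I \<rightarrow> carrier G" "generate G (c' ` I) = generate G (c ` I)"
    and split: "\<And>a::int. c' i [^] a \<in> generate G (c' ` (I - {i})) \<Longrightarrow> c' i [^] a = \<one>"
    by (rule split_off_generator[OF Suc.prems(1) \<open>I \<noteq> {}\<close> Suc.prems(2)]) (rule that)
  have "c' \<in> I - {i} \<rightarrow> carrier G" "n = card (I - {i})" using c' i Suc by auto
  then obtain d' where d': "d' \<in> I - {i} \<rightarrow> carrier G"
    and gen: "generate G (d' ` (I - {i})) = generate G (c' ` (I - {i}))" and ind: "independent_family (I - {i}) d'"
    using Suc.hyps(1)[of "I - {i}" c'] Suc.prems(1) by auto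
  define d where "d = d'(i := c' i)"
  have ci: "c' i \<in> carrier G" using c' i by blast
  have d: "d \<in> I \<rightarrow> carrier G" using d' ci by (auto simp: d_def)
  have img: "d ` J = d' ` J" if "i \<notin> J" for J using that by (auto simp: d_def)
  have ins: "f ` I = insert (f i) (f ` (I - {i}))" for f :: "_ \<Rightarrow> 'a" using i by auto
  have d'G: "d' ` J \<subseteq> carrier G" if "J \<subseteq> I - {i}" for J using d' that by auto
  have "generate G (d ` I) = adjoin (generate G (d' ` (I - {i}))) (c' i)"
    using generate_insert[OF ci d'G[OF subset_refl]] img[of "I - {i}"] unfolding ins[of d] by (simp add: d_def)
  also have "\<dots> = generate G (c' ` I)"
    unfolding gen ins[of c'] using c' by (intro generate_insert[OF ci, symmetric]) auto
  finally have "generate G (d ` I) = generate G (c ` I)" using c'(2) by simp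
  moreover have "independent_family I d"
    unfolding independent_family_def
  proof (intro ballI allI impI)
    fix j and a :: int assume j: "j \<in> I" and a: "d j [^] a \<in> generate G (d ` (I - {j}))"
    show "d j [^] a = \<one>"
    proof (cases "j = i")
      case True
      then show ?thesis using split a gen img[of "I - {i}"] by (simp add: d_def)
    next
      case False
      let ?J = "I - {i} - {j}"
      have "I - {j} = insert i ?J" using i False by auto
      then have "d ` (I - {j}) = insert (c' i) (d' ` ?J)" using img[of ?J] by (auto simp: d_def)
      then have "generate G (d ` (I - {j})) = adjoin (generate G (d' ` ?J)) (c' i)"
        using generate_insert[OF ci d'G[of ?J]] by auto
      then obtain u and k :: int where u: "u \<in> generate G (d' ` ?J)" "d' j [^] a = u \<otimes> c' i [^] k"
        using a False by (auto simp: adjoin_def d_def)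
      have sub: "subgroup (generate G (d' ` (I - {i}))) G" using d'G by (intro generate_is_subgroup) auto
      have uin: "u \<in> generate G (d' ` (I - {i}))"
        using u(1) mono_generate[of "d' ` ?J" "d' ` (I - {i})"] by blast
      have jin: "d' j [^] a \<in> generate G (d' ` (I - {i}))"
        using j False by (intro subgroup_int_pow_closed[OF sub] generate.incl) auto
      have G: "u \<in> carrier G" "d' j \<in> carrier G"
        using subgroup.mem_carrier[OF sub uin] d' j False by auto
      have "c' i [^] k = inv u \<otimes> d' j [^] a" using u(2) G ci by (simp add: inv_solve_left)
      then have "c' i [^] k \<in> generate G (d' ` (I - {i}))"
        using subgroup.m_closed[OF sub subgroup.m_inv_closed[OF sub uin] jin] by simp
      then have "c' i [^] k = \<one>" using split gen by simp
      then have "d' j [^] a \<in> generate G (d' ` ?J)" using u G by simp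
      then show ?thesis using ind j False by (simp add: independent_family_def d_def)
    qed
  qed
  ultimately show ?case using d by blast
qed

text \<open>A product of powers of independent generators is killed by \<open>p\<close> only if each factor is, and a cyclic
  group has finitely many elements that are killed by \<open>p\<close>.\<close>

lemma finite_torsion_of_independent:
  assumes I: "finite I" and d: "d \<in> I \<rightarrow> carrier G" "independent_family I d" and p: "(p::int) \<noteq> 0"
  shows "finite {h \<in> generate G (d ` I). h [^] p = \<one>}"
proof -
  define T where "T i = {v. \<exists>k::int. v = d i [^] k \<and> v [^] p = \<one>}" for i
  have dG: "d i \<in> carrier G" if "i \<in> I" for i using d(1) that by blast
  have fin: "finite (T i)" if i: "i \<in> I" for i
  proof (cases "ord (d i) = 0")
    case True
    have "v = \<one>" if v: "v \<in> T i" for v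
    proof -
      obtain k :: int where k: "v = d i [^] k" "v [^] p = \<one>"
        using v unfolding T_def by blast
      then have "d i [^] (k * p) = \<one>" using dG[OF i] by (simp add: int_pow_pow)
      then have "k * p = 0" using int_pow_eq_id[OF dG[OF i], of "k * p"] True by simp
      then show ?thesis using k p by simp
    qed
    then have "T i \<subseteq> {\<one>}" by blast
    then show ?thesis by (rule finite_subset) simp
  next
    case False
    let ?n = "int (ord (d i))"
    have "T i \<subseteq> (\<lambda>k. d i [^] k) ` {0..<?n}"
    proof
      fix v assume "v \<in> T i"
      then obtain k :: int where k: "v = d i [^] k" unfolding T_def by blast
      have "?n dvd k - k mod ?n" by (simp add: minus_mod_eq_mult_div)
      then have "d i [^] (k - k mod ?n) = \<one>" using int_pow_eq_id[OF dG[OF i]] by blast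
      then have "d i [^] (k - k mod ?n + k mod ?n) = \<one> \<otimes> d i [^] (k mod ?n)"
        using dG[OF i] by (simp only: int_pow_mult)
      then have "v = d i [^] (k mod ?n)" using k dG[OF i] by simp
      moreover have "k mod ?n \<in> {0..<?n}" using False by simp
      ultimately show "v \<in> (\<lambda>k. d i [^] k) ` {0..<?n}" by (rule image_eqI)
    qed
    then show ?thesis using finite_subset by blast
  qed
  have "{h \<in> generate G (d ` I). h [^] p = \<one>} \<subseteq> (\<lambda>v. finprod G v I) ` (Pi\<^sub>E I T)"
  proof
    fix h assume "h \<in> {h \<in> generate G (d ` I). h [^] p = \<one>}"
    then have h: "h \<in> generate G (d ` I)" "h [^] p = \<one>" by auto
    obtain k where k: "h = (\<Otimes>i\<in>I. d i [^] (k i :: int))" using generate_family[OF I d(1) h(1)] by blast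
    have rel: "(\<Otimes>i\<in>I. (d i [^] k i) [^] p) = \<one>"
      using h(2) finprod_int_pow[OF I, of "\<lambda>i. d i [^] k i" p] dG unfolding k by auto
    have "(d i [^] k i) [^] p = \<one>" if i: "i \<in> I" for i
    proof -
      let ?r = "\<Otimes>j\<in>I - {i}. (d j [^] k j) [^] p"
      have sub: "subgroup (generate G (d ` (I - {i}))) G" using dG by (intro generate_is_subgroup) auto
      have r: "?r \<in> generate G (d ` (I - {i}))"
        using I by (intro finprod_in_subgroup[OF sub] subgroup_int_pow_closed[OF sub] generate.incl) auto
      have "(d i [^] k i) [^] p \<otimes> ?r = \<one>"
        using rel finprod_remove[OF I i, of "\<lambda>i. (d i [^] k i) [^] p"] dG by auto
      then have "?r \<otimes> (d i [^] k i) [^] p = \<one>"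
        using dG[OF i] subgroup.mem_carrier[OF sub r] by (simp add: m_comm)
      then have "(d i [^] k i) [^] p = inv ?r"
        using dG[OF i] subgroup.mem_carrier[OF sub r] by (intro eq_inv_of_mult_one) auto
      then have "d i [^] (k i * p) \<in> generate G (d ` (I - {i}))"
        using subgroup.m_inv_closed[OF sub r] dG[OF i] by (simp add: int_pow_pow)
      then show ?thesis using d(2) i dG[OF i] by (simp add: independent_family_def int_pow_pow)
    qed
    then have "(\<lambda>i\<in>I. d i [^] k i) \<in> Pi\<^sub>E I T" by (auto simp: T_def)
    moreover have "h = finprod G (\<lambda>i\<in>I. d i [^] k i) I"
      unfolding k using dG by (intro finprod_cong') auto
    ultimately show "h \<in> (\<lambda>v. finprod G v I) ` (Pi\<^sub>E I T)" by blast
  qed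
  then show ?thesis by (rule finite_subset) (intro finite_imageI finite_PiE[OF I fin])
qed

end

section \<open>Monomorphisms decide the extension property\<close>

text \<open>Realizing the values of \<open>f\<close> at independent generators one at a time and multiplying the resulting
  endomorphisms gives an extension of \<open>f\<close>.\<close>

lemma (in mono_extending) hom_extends:
  assumes fg: "fin_gen_subgroup G H" and f: "f \<in> hom_from H"
  shows "extends_to_endo G H f"
proof -
  obtain I where I: "finite I" "I \<subseteq> carrier G" "H = generate G I"
    using fg unfolding fin_gen_subgroup_def by blast
  obtain d where d: "d \<in> I \<rightarrow> carrier G" "generate G (d ` I) = H" "independent_family I d"
    using independent_generators_exist[OF I(1), of "\<lambda>x. x"] I by auto
  have dG: "d i \<in> carrier G" if "i \<in> I" for i using d(1) that by blast
  have dH: "d i \<in> H" if "i \<in> I" for i using that d(2) by (auto intro: generate.incl)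
  have fG: "f (d i) \<in> carrier G" if "i \<in> I" for i using hom_from_closed[OF f dH[OF that]] .
  have fin: "finite {h \<in> H. h [^] p = \<one>}" if "prime p" for p :: int
    using finite_torsion_of_independent[OF I(1) d(1,3), of p] that d(2) by auto
  have "realizable (generate G (d ` (I - {i}))) (d i) (f (d i))" if i: "i \<in> I" for i
  proof (rule realizable_any[OF _ fin fG[OF i]])
    have "d ` I = insert (d i) (d ` (I - {i}))" using i by auto
    then have "H = adjoin (generate G (d ` (I - {i}))) (d i)"
      using generate_insert[OF dG[OF i], of "d ` (I - {i})"] d(1,2) by auto
    then show "splits (generate G (d ` (I - {i}))) (d i)"
      using dG i d(3) generate_is_subgroup[of "d ` (I - {i})"] unfolding splits_def independent_family_def by auto
    show "f (d i) [^] k = \<one>" if "d i [^] k = \<one>" for k :: int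
      using hom_from_pow[OF f H dH[OF i], of k] hom_from_one[OF f H] that by simp
  qed
  then have "\<forall>i\<in>I. \<exists>F\<in>hom G G. F (d i) = f (d i) \<and> (\<forall>b\<in>generate G (d ` (I - {i})). F b = \<one>)"
    unfolding realizable_def by blast
  then obtain F where F: "\<And>i. i \<in> I \<Longrightarrow> F i \<in> hom G G" "\<And>i. i \<in> I \<Longrightarrow> F i (d i) = f (d i)"
    "\<And>i b. i \<in> I \<Longrightarrow> b \<in> generate G (d ` (I - {i})) \<Longrightarrow> F i b = \<one>"
    by metis
  let ?F = "\<lambda>x. \<Otimes>i\<in>I. F i x"
  have FG: "F i x \<in> carrier G" if "i \<in> I" "x \<in> carrier G" for i x
    using F(1)[OF that(1)] that(2) by (auto simp: hom_def)
  have hom: "?F \<in> hom G G"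
  proof (rule homI)
    show "?F x \<in> carrier G" if "x \<in> carrier G" for x using FG that by (intro finprod_closed) auto
    fix x y assume xy: "x \<in> carrier G" "y \<in> carrier G"
    have "?F (x \<otimes> y) = (\<Otimes>i\<in>I. F i x \<otimes> F i y)"
      using FG xy hom_mult[OF F(1)] by (intro finprod_cong') auto
    also have "\<dots> = ?F x \<otimes> ?F y" using FG xy by (intro finprod_multf) auto
    finally show "?F (x \<otimes> y) = ?F x \<otimes> ?F y" .
  qed
  have gens: "?F (d j) = f (d j)" if j: "j \<in> I" for j
  proof -
    have "F i (d j) = \<one>" if "i \<in> I" "i \<noteq> j" for i
      using F(3)[OF that(1)] j that(2) by (auto intro: generate.incl)
    then have "(\<Otimes>i\<in>I - {j}. F i (d j)) = \<one>" by (intro finprod_one_eqI) auto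
    then show ?thesis using finprod_remove[OF I(1) j, of "\<lambda>i. F i (d j)"] FG dG[OF j] F(2)[OF j] j fG[OF j] by auto
  qed
  have "?F h = f h" if "h \<in> generate G (d ` I)" for h
    using that
  proof induction
    case one
    then show ?case using endo_one[OF hom] hom_from_one[OF f H] by simp
  next
    case (incl h)
    then show ?case using gens by auto
  next
    case (inv h)
    then obtain j where j: "j \<in> I" "h = d j" by blast
    have "?F (inv h) = inv (?F h)" using endo_hom_from[OF H hom] hom_from_inv[OF _ H dH[OF j(1)]] j(2) by simp
    also have "\<dots> = f (inv h)" using hom_from_inv[OF f H dH[OF j(1)]] gens[OF j(1)] j(2) by simp
    finally show ?case .
  next
    case (eng h1 h2)
    then have "h1 \<in> H" "h2 \<in> H" using d(2) by auto
    then show ?case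
      using eng hom_from_mult[OF f] hom_mult[OF hom] subgroup.mem_carrier[OF H] by simp
  qed
  then show ?thesis unfolding extends_to_endo_def using hom d(2) by (intro bexI[of _ ?F]) auto
qed

theorem theorem4p4:
  fixes G :: "('a, 'b) monoid_scheme"
  assumes "comm_group G"
  shows "Pf_subgroups G = Qf_subgroups G"
proof -
  interpret comm_group G by fact
  have "H \<in> Q_subgroups G" if "H \<in> P_subgroups G" "fin_gen_subgroup G H" for H
  proof -
    interpret mono_extending G H
      by (intro mono_extending.intro mono_extending_axioms.intro comm_group_axioms)
        (use that(1) in \<open>auto simp: P_subgroups_def\<close>)
    show ?thesis using H hom_extends[OF that(2)] by (auto simp: Q_subgroups_def)
  qed
  moreover have "Q_subgroups G \<subseteq> P_subgroups G"
    by (auto simp: Q_subgroups_def P_subgroups_def mon_def)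
  ultimately show ?thesis by (auto simp: Pf_subgroups_def Qf_subgroups_def)
qed

end
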